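(* For each $N\ge1$ let $\eta^N(t)$ be an irreducible continuous-time Markov chain on a finite set $\Omega_N$ with jump rates $R_N(\eta,\xi)$, $\eta\ne\xi$, and unique stationary distribution $\nu_N$. Let $A_N\subset\Omega_N$ satisfy $\lim_{N\to\infty}\nu_N(A_N)=0$, let $H_N=\inf\{t>0:\eta^N(t)\in A_N\}$, and assume $T^{\rm mix}_N\ll r_N(A_N^c,A_N)^{-1}$. Then, for the chain started from $\nu_N$, $H_N/\mathbb E_{\nu_N}[H_N]$ converges in distribution, as $N\to\infty$, to a mean one exponential random variable.
   Context: $P_t(\eta,\xi)=\mathbb P_\eta[\eta^N(t)=\xi]$; the mixing time is $T^{\rm mix}_N=\inf\{t>0:\max_{\eta\in\Omega_N}\|P_t(\eta,\cdot)-\nu_N\|_{\rm TV}\le 1/4\}$. For $\xi\in\Omega_N$, $R_N(\xi,A_N)=\sum_{\zeta\in A_N}R_N(\xi,\zeta)$, and $r_N(A_N^c,A_N)=\frac1{\nu_N(A_N^c)}\sum_{\xi\in A_N^c}\nu_N(\xi)R_N(\xi,A_N)$. For positive sequences, $a_N\ll b_N$ means $a_N/b_N\to0$. $\mathbb P_\mu,\mathbb E_\mu$ denote the law and expectation of the chain started from the distribution $\mu$. *)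

theory Defs
  imports "HOL-Probability.Probability"
begin

text \<open>Generator (Q-matrix) of the chain on the finite state set Om with jump rates R;
  it vanishes outside Om x Om; the diagonal of R is ignored.\<close>
definition generator :: "'a set \<Rightarrow> ('a \<Rightarrow> 'a \<Rightarrow> real) \<Rightarrow> 'a \<Rightarrow> 'a \<Rightarrow> real" where
  "generator Om R x y =
     (if x \<in> Om \<and> y \<in> Om then
        (if x = y then - (\<Sum>z\<in>Om - {x}. R x z) else R x y)
      else 0)"

text \<open>Matrix powers over the index set Om.\<close>
fun matpow :: "'a set \<Rightarrow> ('a \<Rightarrow> 'a \<Rightarrow> real) \<Rightarrow> nat \<Rightarrow> 'a \<Rightarrow> 'a \<Rightarrow> real" where
  "matpow Om L 0 = (\<lambda>x y. if x = y then 1 else 0)"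
| "matpow Om L (Suc n) = (\<lambda>x y. \<Sum>z\<in>Om. matpow Om L n x z * L z y)"

text \<open>Transition function P_t = exp(t L) (matrix exponential series).\<close>
definition trans_fun :: "'a set \<Rightarrow> ('a \<Rightarrow> 'a \<Rightarrow> real) \<Rightarrow> real \<Rightarrow> 'a \<Rightarrow> 'a \<Rightarrow> real" where
  "trans_fun Om R t x y = (\<Sum>n. t ^ n / fact n * matpow Om (generator Om R) n x y)"

definition nonneg_rates :: "'a set \<Rightarrow> ('a \<Rightarrow> 'a \<Rightarrow> real) \<Rightarrow> bool" where
  "nonneg_rates Om R \<longleftrightarrow> (\<forall>x\<in>Om. \<forall>y\<in>Om. x \<noteq> y \<longrightarrow> R x y \<ge> 0)"

definition irreducible_chain :: "'a set \<Rightarrow> ('a \<Rightarrow> 'a \<Rightarrow> real) \<Rightarrow> bool" where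
  "irreducible_chain Om R \<longleftrightarrow>
     (\<forall>x\<in>Om. \<forall>y\<in>Om. (x, y) \<in> {(u, v). u \<in> Om \<and> v \<in> Om \<and> u \<noteq> v \<and> R u v > 0}\<^sup>*)"

definition is_distribution :: "'a set \<Rightarrow> ('a \<Rightarrow> real) \<Rightarrow> bool" where
  "is_distribution Om \<mu> \<longleftrightarrow> (\<forall>x. \<mu> x \<ge> 0) \<and> (\<forall>x. x \<notin> Om \<longrightarrow> \<mu> x = 0) \<and> (\<Sum>x\<in>Om. \<mu> x) = 1"

definition stationary :: "'a set \<Rightarrow> ('a \<Rightarrow> 'a \<Rightarrow> real) \<Rightarrow> ('a \<Rightarrow> real) \<Rightarrow> bool" where
  "stationary Om R \<nu> \<longleftrightarrow> is_distribution Om \<nu> \<and>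
     (\<forall>y\<in>Om. (\<Sum>x\<in>Om. \<nu> x * generator Om R x y) = 0)"

definition unique_stationary :: "'a set \<Rightarrow> ('a \<Rightarrow> 'a \<Rightarrow> real) \<Rightarrow> ('a \<Rightarrow> real) \<Rightarrow> bool" where
  "unique_stationary Om R \<nu> \<longleftrightarrow> stationary Om R \<nu> \<and> (\<forall>\<mu>. stationary Om R \<mu> \<longrightarrow> \<mu> = \<nu>)"

definition tv_dist :: "'a set \<Rightarrow> ('a \<Rightarrow> real) \<Rightarrow> ('a \<Rightarrow> real) \<Rightarrow> real" where
  "tv_dist Om \<mu> \<nu> = (\<Sum>x\<in>Om. \<bar>\<mu> x - \<nu> x\<bar>) / 2"

definition mixing_time :: "'a set \<Rightarrow> ('a \<Rightarrow> 'a \<Rightarrow> real) \<Rightarrow> ('a \<Rightarrow> real) \<Rightarrow> real" where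
  "mixing_time Om R \<nu> =
     Inf {t. t > 0 \<and> (\<forall>\<eta>\<in>Om. tv_dist Om (trans_fun Om R t \<eta>) \<nu> \<le> 1/4)}"

text \<open>Mean rate r_N(A^c, A) of jumps from A^c into A under the stationary law.\<close>
definition rate_into :: "'a set \<Rightarrow> ('a \<Rightarrow> 'a \<Rightarrow> real) \<Rightarrow> ('a \<Rightarrow> real) \<Rightarrow> 'a set \<Rightarrow> real" where
  "rate_into Om R \<nu> A =
     (1 / (\<Sum>x\<in>Om - A. \<nu> x)) * (\<Sum>\<xi>\<in>Om - A. \<nu> \<xi> * (\<Sum>\<zeta>\<in>A. R \<xi> \<zeta>))"

text \<open>X is (a realisation on the probability space M of) the continuous-time Markov chain
  with state space Om, jump rates R and initial law \<mu>: states in Om, right-continuous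
  (piecewise constant) paths, and finite-dimensional distributions given by P_t.\<close>
definition ctmc_process :: "'b measure \<Rightarrow> (real \<Rightarrow> 'b \<Rightarrow> 'a) \<Rightarrow> 'a set \<Rightarrow>
     ('a \<Rightarrow> 'a \<Rightarrow> real) \<Rightarrow> ('a \<Rightarrow> real) \<Rightarrow> bool" where
  "ctmc_process M X Om R \<mu> \<longleftrightarrow>
     prob_space M \<and>
     (\<forall>t\<ge>0. X t \<in> measurable M (count_space UNIV)) \<and>
     (\<forall>\<omega>\<in>space M. \<forall>t\<ge>0. X t \<omega> \<in> Om) \<and>
     (\<forall>\<omega>\<in>space M. \<forall>t\<ge>0. \<exists>e>0. \<forall>s. t \<le> s \<and> s < t + e \<longrightarrow> X s \<omega> = X t \<omega>) \<and>
     (\<forall>n (ts :: nat \<Rightarrow> real) (xs :: nat \<Rightarrow> 'a). ts 0 = 0 \<longrightarrow> (\<forall>i<n. ts i \<le> ts (Suc i)) \<longrightarrow>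
        measure M {\<omega> \<in> space M. \<forall>i\<le>n. X (ts i) \<omega> = xs i} =
        \<mu> (xs 0) * (\<Prod>i<n. trans_fun Om R (ts (Suc i) - ts i) (xs i) (xs (Suc i))))"

definition hitting_time :: "(real \<Rightarrow> 'b \<Rightarrow> 'a) \<Rightarrow> 'a set \<Rightarrow> 'b \<Rightarrow> real" where
  "hitting_time X A \<omega> = Inf {t. t > 0 \<and> X t \<omega> \<in> A}"

end

theory Submission
  imports Defs
begin

text \<open>
  Let \<open>f t\<close> be the stationary probability that \<open>A\<close> is avoided up to time \<open>t\<close>. A gap of length \<open>S\<close>
  inserted between two time windows makes them independent up to an error \<open>D\<close>, the distance from
  equilibrium at time \<open>S\<close>, while by stationarity \<open>A\<close> is entered during the gap with probability at
  most \<open>r S\<close>. Hence \<open>f (t + s)\<close> differs from \<open>f t * f s\<close> by at most \<open>D + r S\<close>. Taking for \<open>S\<close> a large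
  multiple of the mixing time makes \<open>D\<close> small, and \<open>r S\<close> still tends to 0 by assumption. So if
  \<open>\<theta>\<close> is the time with \<open>f \<theta> = 1/e\<close>, then \<open>f (\<theta> u)\<close> tends to \<open>exp (- u)\<close>. The one-sided bound
  \<open>f (t + S + s) \<le> f t (f s + D)\<close> makes \<open>u \<mapsto> f (\<theta> u)\<close> decay geometrically, uniformly in \<open>N\<close>, so by
  dominated convergence the mean hitting time, which is the integral of \<open>f\<close>, is asymptotic to \<open>\<theta>\<close>.
\<close>

section \<open>The transition function\<close>

text \<open>The hypothesis \<open>ctmc_process\<close> supplies finite-dimensional distributions and
  right-continuous paths, but no Markov property of the path law. Decoupling and the entrance bound
  are therefore proved for finitely many observation times and carried over to windows along dyadic
  grids. Nonnegativity, row sums and the semigroup law of \<open>P\<close> are also read off from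
  the process: they are identities between joint probabilities, divided by \<open>\<nu> x\<close>,
  which is positive by irreducibility. The exponential series serves only for the value and
  derivative at 0 and for invariance of \<open>\<nu>\<close>. The mixing time is an infimum of reals
  and carries information only if its set is nonempty, so convergence to equilibrium has to be
  proved for each chain. The normalisation by \<open>\<theta>\<close> precedes that by the mean
  because its value 1/e is exact for each \<open>N\<close>, while convergence of the rescaled laws
  alone would not control the means.\<close>

lemma sum_abs_matpow_le:
  assumes "finite Om" "x \<in> Om"
  shows "(\<Sum>y\<in>Om. \<bar>matpow Om L n x y\<bar>) \<le> (\<Sum>z\<in>Om. \<Sum>y\<in>Om. \<bar>L z y\<bar>) ^ n"
proof (induction n)
  case 0
  have "(\<Sum>y\<in>Om. \<bar>matpow Om L 0 x y\<bar>) = (\<Sum>y\<in>Om. if x = y then 1 else 0)"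
    by (intro sum.cong) auto
  then show ?case using assms by simp
next
  case (Suc n)
  let ?K = "\<Sum>z\<in>Om. \<Sum>y\<in>Om. \<bar>L z y\<bar>"
  have "(\<Sum>y\<in>Om. \<bar>matpow Om L (Suc n) x y\<bar>) \<le> (\<Sum>y\<in>Om. \<Sum>z\<in>Om. \<bar>matpow Om L n x z\<bar> * \<bar>L z y\<bar>)"
    by (auto intro!: sum_mono order_trans[OF sum_abs] simp: abs_mult)
  also have "\<dots> = (\<Sum>z\<in>Om. \<bar>matpow Om L n x z\<bar> * (\<Sum>y\<in>Om. \<bar>L z y\<bar>))"
    by (subst sum.swap) (simp add: sum_distrib_left)
  also have "\<dots> \<le> (\<Sum>z\<in>Om. \<bar>matpow Om L n x z\<bar> * ?K)"
    using assms by (intro sum_mono mult_left_mono member_le_sum) (auto intro: sum_nonneg)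
  also have "\<dots> = (\<Sum>z\<in>Om. \<bar>matpow Om L n x z\<bar>) * ?K"
    by (simp add: sum_distrib_right)
  also have "\<dots> \<le> ?K ^ n * ?K"
    by (intro mult_right_mono Suc) (auto intro!: sum_nonneg)
  finally show ?case by (simp add: mult.commute)
qed

lemma summable_matpow_series:
  assumes "finite Om" "x \<in> Om" "y \<in> Om"
  shows "summable (\<lambda>n. matpow Om L n x y / fact n * t ^ n)"
proof (rule summable_comparison_test)
  let ?K = "\<Sum>z\<in>Om. \<Sum>y\<in>Om. \<bar>L z y\<bar>"
  show "summable (\<lambda>n. (?K * \<bar>t\<bar>) ^ n / fact n)"
    using summable_exp_generic[of "?K * \<bar>t\<bar>"] by (simp add: divide_inverse mult.commute)
  have "norm (matpow Om L n x y / fact n * t ^ n) \<le> (?K * \<bar>t\<bar>) ^ n / fact n" for n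
  proof -
    have "\<bar>matpow Om L n x y\<bar> \<le> (\<Sum>y\<in>Om. \<bar>matpow Om L n x y\<bar>)"
      using assms by (intro member_le_sum) auto
    also have "\<dots> \<le> ?K ^ n" using sum_abs_matpow_le[OF assms(1,2)] .
    finally have "\<bar>matpow Om L n x y\<bar> * \<bar>t\<bar> ^ n / fact n \<le> ?K ^ n * \<bar>t\<bar> ^ n / fact n"
      by (intro divide_right_mono mult_right_mono) auto
    then show ?thesis by (simp add: abs_mult power_abs power_mult_distrib)
  qed
  then show "\<exists>N. \<forall>n\<ge>N. norm (matpow Om L n x y / fact n * t ^ n) \<le> (?K * \<bar>t\<bar>) ^ n / fact n"
    by blast
qed

text \<open>Puts the coefficient first and \<open>t ^ n\<close> last, the shape in which the library
  differentiates power series and evaluates them at 0.\<close>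

lemma trans_fun_powser:
  "trans_fun Om R t x y = (\<Sum>n. matpow Om (generator Om R) n x y / fact n * t ^ n)"
  unfolding trans_fun_def by (simp add: mult.commute)

lemma trans_fun_0: "trans_fun Om R 0 x y = (if x = y then 1 else 0)"
  unfolding trans_fun_powser by (subst powser_zero) simp

lemma DERIV_trans_fun_0:
  assumes "finite Om" "x \<in> Om" "y \<in> Om"
  shows "((\<lambda>t. trans_fun Om R t x y) has_field_derivative generator Om R x y) (at 0)"
proof -
  let ?c = "\<lambda>n. matpow Om (generator Om R) n x y / fact n"
  have "((\<lambda>t. \<Sum>n. ?c n * t ^ n) has_field_derivative (\<Sum>n. diffs ?c n * 0 ^ n)) (at 0)"
    using summable_matpow_series[OF assms] by (intro termdiffs_strong_converges_everywhere) auto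
  also have "(\<Sum>n. diffs ?c n * 0 ^ n) = diffs ?c 0" by (rule powser_zero)
  \<comment> \<open>The coefficient of \<open>t\<close> is the first matrix power, that is, the
    identity matrix times the generator.\<close>
  also have "diffs ?c 0 = (\<Sum>z\<in>Om. (if x = z then generator Om R z y else 0))"
    by (simp add: diffs_def if_distrib[where f="\<lambda>a. a * _"] cong: if_cong)
  also have "\<dots> = generator Om R x y" using assms by simp
  finally show ?thesis unfolding trans_fun_powser .
qed

text \<open>Since \<open>\<nu>\<close> is annihilated by the generator, it is annihilated by every
  positive power, and only the constant term of the series survives.\<close>

lemma stationary_trans_fun:
  assumes "finite Om" "stationary Om R \<nu>" "y \<in> Om"
  shows "(\<Sum>x\<in>Om. \<nu> x * trans_fun Om R t x y) = \<nu> y"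
proof -
  let ?L = "generator Om R"
  have step: "(\<Sum>x\<in>Om. \<nu> x * matpow Om ?L n x y) = (if n = 0 then \<nu> y else 0)" if "y \<in> Om" for n y
    using that
  proof (induction n arbitrary: y)
    case 0
    then show ?case using assms by (simp add: if_distrib cong: if_cong)
  next
    case (Suc n)
    have "(\<Sum>x\<in>Om. \<nu> x * matpow Om ?L (Suc n) x y)
        = (\<Sum>z\<in>Om. (\<Sum>x\<in>Om. \<nu> x * matpow Om ?L n x z) * ?L z y)"
      by (simp add: sum_distrib_left sum_distrib_right mult.assoc) (rule sum.swap)
    also have "\<dots> = (if n = 0 then (\<Sum>z\<in>Om. \<nu> z * ?L z y) else 0)"
      using Suc.IH by simp
    finally show ?case using assms(2) Suc.prems unfolding stationary_def by simp
  qed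
  have "(\<lambda>n. \<Sum>x\<in>Om. \<nu> x * (matpow Om ?L n x y / fact n * t ^ n)) sums
      (\<Sum>x\<in>Om. \<nu> x * trans_fun Om R t x y)"
    unfolding trans_fun_powser using assms
    by (intro sums_sum sums_mult summable_sums summable_matpow_series) auto
  moreover have "(\<Sum>x\<in>Om. \<nu> x * (matpow Om ?L n x y / fact n * t ^ n)) = (if n = 0 then \<nu> y else 0)" for n
  proof -
    have "(\<Sum>x\<in>Om. \<nu> x * (matpow Om ?L n x y / fact n * t ^ n))
        = (\<Sum>x\<in>Om. \<nu> x * matpow Om ?L n x y) / fact n * t ^ n"
      by (simp add: sum_distrib_right sum_divide_distrib mult.assoc)
    then show ?thesis using step[OF assms(3)] by simp
  qed
  moreover have "(\<lambda>n::nat. if n = 0 then \<nu> y else 0) sums \<nu> y"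
    using sums_single[of 0 "\<lambda>_. \<nu> y"] by simp
  ultimately show ?thesis using sums_unique2 by simp
qed

text \<open>In the balance equation at a state of mass zero the diagonal term vanishes, so the
  nonnegative inflows sum to zero and every predecessor has mass zero too. Followed backwards along
  paths leading to \<open>y\<close>, this empties all of \<open>Om\<close>, against total mass
  1.\<close>

lemma stationary_pos:
  assumes "finite Om" "nonneg_rates Om R" "irreducible_chain Om R" "stationary Om R \<nu>" "y \<in> Om"
  shows "\<nu> y > 0"
proof (rule ccontr)
  assume "\<not> \<nu> y > 0"
  have nn: "\<nu> x \<ge> 0" for x using assms(4) by (simp add: stationary_def is_distribution_def)
  then have y0: "\<nu> y = 0" using \<open>\<not> \<nu> y > 0\<close> by (meson linorder_not_less order_antisym_conv)
  let ?E = "{(u, v). u \<in> Om \<and> v \<in> Om \<and> u \<noteq> v \<and> R u v > 0}"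
  have pred_zero: "\<nu> u = 0" if "(u, v) \<in> ?E" "\<nu> v = 0" for u v
  proof -
    have uv: "u \<in> Om" "v \<in> Om" "u \<noteq> v" "R u v > 0" using that by auto
    have "0 = (\<Sum>x\<in>Om. \<nu> x * generator Om R x v)"
      using assms(4) uv unfolding stationary_def by simp
    also have "\<dots> = \<nu> v * generator Om R v v + (\<Sum>x\<in>Om-{v}. \<nu> x * generator Om R x v)"
      using assms(1) uv by (intro sum.remove)
    also have "\<dots> = (\<Sum>x\<in>Om-{v}. \<nu> x * R x v)"
      using that(2) uv by (auto intro!: sum.cong simp: generator_def)
    finally have "(\<Sum>x\<in>Om-{v}. \<nu> x * R x v) = 0" by simp
    moreover have "\<forall>x\<in>Om-{v}. 0 \<le> \<nu> x * R x v"
      using nn assms(2) uv by (auto simp: nonneg_rates_def)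
    ultimately have "\<forall>x\<in>Om-{v}. \<nu> x * R x v = 0"
      using assms(1) by (subst (asm) sum_nonneg_eq_0_iff) auto
    then show ?thesis using uv by auto
  qed
  have "\<nu> x = 0" if "(x, y) \<in> ?E\<^sup>*" for x
    using that y0 by (induction rule: converse_rtrancl_induct) (use pred_zero in auto)
  then have "\<nu> x = 0" if "x \<in> Om" for x
    using that assms(3,5) unfolding irreducible_chain_def by blast
  then show False using assms(4) by (simp add: stationary_def is_distribution_def)
qed

section \<open>Finite-dimensional distributions of the stationary chain\<close>

locale stationary_ctmc = prob_space M for M :: "'b measure" +
  fixes Om :: "'a set" and R :: "'a \<Rightarrow> 'a \<Rightarrow> real" and \<nu> :: "'a \<Rightarrow> real" and X :: "real \<Rightarrow> 'b \<Rightarrow> 'a"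
  assumes fin: "finite Om"
    and rates: "nonneg_rates Om R"
    and irred: "irreducible_chain Om R"
    and stat: "stationary Om R \<nu>"
    and proc: "ctmc_process M X Om R \<nu>"
begin

abbreviation "P \<equiv> trans_fun Om R"

lemma nu_pos: "x \<in> Om \<Longrightarrow> \<nu> x > 0"
  using stationary_pos[OF fin rates irred stat] .

lemma nu_nonneg: "\<nu> x \<ge> 0" and nu_sum: "(\<Sum>x\<in>Om. \<nu> x) = 1"
  using stat by (auto simp: stationary_def is_distribution_def)

lemma X_measurable: "t \<ge> 0 \<Longrightarrow> X t \<in> measurable M (count_space UNIV)"
  and X_in: "\<omega> \<in> space M \<Longrightarrow> t \<ge> 0 \<Longrightarrow> X t \<omega> \<in> Om"
  and X_right_cont: "\<omega> \<in> space M \<Longrightarrow> t \<ge> 0 \<Longrightarrow> \<exists>e>0. \<forall>s. t \<le> s \<and> s < t + e \<longrightarrow> X s \<omega> = X t \<omega>"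
  using proc unfolding ctmc_process_def by simp_all

lemma X_fdd:
  assumes "ts 0 = 0" "\<And>i. i < n \<Longrightarrow> ts i \<le> ts (Suc i)"
  shows "prob {\<omega> \<in> space M. \<forall>i\<le>n. X (ts i) \<omega> = xs i} =
        \<nu> (xs 0) * (\<Prod>i<n. P (ts (Suc i) - ts i) (xs i) (xs (Suc i)))"
  using proc assms unfolding ctmc_process_def by simp

lemma X_sets: "t \<ge> 0 \<Longrightarrow> {\<omega> \<in> space M. X t \<omega> \<in> C} \<in> sets M"
  using measurable_sets[OF X_measurable, of t C] by (simp add: vimage_def Int_def conj_commute)

lemma X_sets_ball:
  assumes "finite I" "\<And>i. i \<in> I \<Longrightarrow> ts i \<ge> 0"
  shows "{\<omega> \<in> space M. \<forall>i\<in>I. X (ts i) \<omega> \<in> C i} \<in> sets M"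
  using assms by (intro sets.sets_Collect_finite_All X_sets) auto

text \<open>\<open>fw ts C j z\<close> is the probability that the chain is in \<open>C i\<close> at time \<open>ts i\<close> for all \<open>i < j\<close>
  and in \<open>z\<close> at time \<open>ts j\<close>.\<close>

primrec fw :: "(nat \<Rightarrow> real) \<Rightarrow> (nat \<Rightarrow> 'a set) \<Rightarrow> nat \<Rightarrow> 'a \<Rightarrow> real" where
  "fw ts C 0 = \<nu>"
| "fw ts C (Suc j) = (\<lambda>z. \<Sum>y\<in>C j. fw ts C j y * P (ts (Suc j) - ts j) y z)"

lemma incr_nonneg:
  assumes "ts 0 = (0::real)" "\<And>i. i < n \<Longrightarrow> ts i \<le> ts (Suc i)" "i \<le> n"
  shows "ts i \<ge> 0"
  using assms(3) by (induction i) (use assms in \<open>auto intro: order_trans\<close>)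

text \<open>Interpolates between \<open>X_fdd\<close> (\<open>j = 0\<close>, every state prescribed)
  and the case \<open>j = n\<close>, in which only the last state is prescribed. Each induction step
  sums over the state at time \<open>ts j\<close> and thereby moves one factor of the product into
  \<open>fw\<close>.\<close>

lemma prob_path_prefix:
  assumes ts: "ts 0 = 0" "\<And>i. i < n \<Longrightarrow> ts i \<le> ts (Suc i)" and C: "\<And>i. C i \<subseteq> Om" and "j \<le> n"
  shows "prob {\<omega> \<in> space M. (\<forall>i<j. X (ts i) \<omega> \<in> C i) \<and> (\<forall>i\<in>{j..n}. X (ts i) \<omega> = xs i)}
     = fw ts C j (xs j) * (\<Prod>i\<in>{j..<n}. P (ts (Suc i) - ts i) (xs i) (xs (Suc i)))"
  using \<open>j \<le> n\<close>
proof (induction j arbitrary: xs)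
  case 0
  have "{0..n} = {..n}" by auto
  then show ?case using X_fdd[OF ts, of n xs] by (simp add: atLeast0LessThan Ball_def)
next
  case (Suc j)
  note tpos = incr_nonneg[OF ts]
  let ?E = "\<lambda>xs. {\<omega> \<in> space M. (\<forall>i<j. X (ts i) \<omega> \<in> C i) \<and> (\<forall>i\<in>{j..n}. X (ts i) \<omega> = xs i)}"
  have split: "{j..n} = insert j {Suc j..n}" using Suc.prems by auto
  have eq: "{\<omega> \<in> space M. (\<forall>i<Suc j. X (ts i) \<omega> \<in> C i) \<and> (\<forall>i\<in>{Suc j..n}. X (ts i) \<omega> = xs i)}
      = (\<Union>y\<in>C j. ?E (xs(j := y)))"
    unfolding split by (auto simp: less_Suc_eq)
  have meas: "?E ys \<in> sets M" for ys
  proof -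
    have "?E ys = {\<omega> \<in> space M. \<forall>i\<in>{..n}. X (ts i) \<omega> \<in> (if i < j then C i else {ys i})}"
    proof (intro Collect_cong conj_cong refl iffI ballI conjI allI impI)
      fix \<omega> i assume h: "\<forall>i\<in>{..n}. X (ts i) \<omega> \<in> (if i < j then C i else {ys i})"
      show "X (ts i) \<omega> \<in> C i" if "i < j" using bspec[OF h, of i] that Suc.prems by simp
      show "X (ts i) \<omega> = ys i" if "i \<in> {j..n}" using bspec[OF h, of i] that by simp
    qed auto
    also have "\<dots> \<in> sets M" by (rule X_sets_ball) (use tpos in auto)
    finally show ?thesis .
  qed
  have "prob (\<Union>y\<in>C j. ?E (xs(j := y))) = (\<Sum>y\<in>C j. prob (?E (xs(j := y))))"
  proof (rule finite_measure_finite_Union)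
    show "finite (C j)" using C fin finite_subset by blast
    show "disjoint_family_on (\<lambda>y. ?E (xs(j := y))) (C j)"
      unfolding disjoint_family_on_def split by auto
    show "(\<lambda>y. ?E (xs(j := y))) ` C j \<subseteq> events" using meas by blast
  qed
  also have "\<dots> = (\<Sum>y\<in>C j. fw ts C j y * P (ts (Suc j) - ts j) y (xs (Suc j)) *
       (\<Prod>i\<in>{Suc j..<n}. P (ts (Suc i) - ts i) (xs i) (xs (Suc i))))"
  proof (rule sum.cong[OF refl])
    fix y assume "y \<in> C j"
    have "prob (?E (xs(j := y))) = fw ts C j y *
       (\<Prod>i\<in>{j..<n}. P (ts (Suc i) - ts i) ((xs(j := y)) i) ((xs(j := y)) (Suc i)))"
      using Suc.IH[of "xs(j := y)"] Suc.prems by simp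
    also have "{j..<n} = insert j {Suc j..<n}" using Suc.prems by auto
    finally show "prob (?E (xs(j := y))) = fw ts C j y * P (ts (Suc j) - ts j) y (xs (Suc j)) *
       (\<Prod>i\<in>{Suc j..<n}. P (ts (Suc i) - ts i) (xs i) (xs (Suc i)))"
      by (simp add: mult.assoc)
  qed
  finally show ?case unfolding eq by (simp add: sum_distrib_right)
qed

lemma prob_path:
  assumes ts: "ts 0 = 0" "\<And>i. i < n \<Longrightarrow> ts i \<le> ts (Suc i)" and C: "\<And>i. C i \<subseteq> Om"
  shows "prob {\<omega> \<in> space M. \<forall>i\<le>n. X (ts i) \<omega> \<in> C i} = (\<Sum>y\<in>C n. fw ts C n y)"
proof -
  note tpos = incr_nonneg[OF ts]
  let ?E = "\<lambda>y. {\<omega> \<in> space M. \<forall>i\<in>{..n}. X (ts i) \<omega> \<in> (if i < n then C i else {y})}"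
  have 1: "{\<omega> \<in> space M. \<forall>i\<le>n. X (ts i) \<omega> \<in> C i} = (\<Union>y\<in>C n. {\<omega> \<in> space M. (\<forall>i<n. X (ts i) \<omega> \<in> C i) \<and> (\<forall>i\<in>{n..n}. X (ts i) \<omega> = y)})"
    by (auto simp: le_less)
  have 2: "{\<omega> \<in> space M. (\<forall>i<n. X (ts i) \<omega> \<in> C i) \<and> (\<forall>i\<in>{n..n}. X (ts i) \<omega> = y)} = ?E y" for y
    by (auto simp: le_less split: if_splits)
  have "prob (\<Union>y\<in>C n. ?E y) = (\<Sum>y\<in>C n. prob (?E y))"
  proof (rule finite_measure_finite_Union)
    show "finite (C n)" using C fin finite_subset by blast
    show "disjoint_family_on ?E (C n)"
      unfolding disjoint_family_on_def by auto
    have "?E y \<in> events" for y by (rule X_sets_ball) (use tpos in auto)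
    then show "?E ` C n \<subseteq> events" by blast
  qed
  also have "\<dots> = (\<Sum>y\<in>C n. fw ts C n y)"
    using prob_path_prefix[OF ts C order_refl, where xs="\<lambda>_. y" for y]
    unfolding 2[symmetric] by simp
  finally show ?thesis unfolding 1 2 .
qed

text \<open>The sign of \<open>P\<close> is not yet known at this point, so nonnegativity comes from
  reading the value as a probability.\<close>

lemma fw_nonneg_path:
  assumes ts: "ts 0 = 0" "\<And>i. i < n \<Longrightarrow> ts i \<le> ts (Suc i)" and C: "\<And>i. C i \<subseteq> Om"
  shows "fw ts C n y \<ge> 0"
proof -
  have "fw ts C n y = prob {\<omega> \<in> space M. (\<forall>i<n. X (ts i) \<omega> \<in> C i) \<and> (\<forall>i\<in>{n..n}. X (ts i) \<omega> = y)}"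
    using prob_path_prefix[OF ts C order_refl, where xs="\<lambda>_. y"] by simp
  then show ?thesis by simp
qed

lemma nu_P: "y \<in> Om \<Longrightarrow> (\<Sum>x\<in>Om. \<nu> x * P t x y) = \<nu> y"
  using stationary_trans_fun[OF fin stat] .

text \<open>Observation sequences have to start at time 0, so a void observation in
  \<open>Om\<close> is put in front; by invariance it hands on \<open>\<nu>\<close> as the law at
  time \<open>s\<close>.\<close>

lemma prob_two_times:
  assumes "s \<ge> 0" "h \<ge> 0" "C \<subseteq> Om" "D \<subseteq> Om"
  shows "prob {\<omega> \<in> space M. X s \<omega> \<in> C \<and> X (s + h) \<omega> \<in> D} = (\<Sum>y\<in>D. \<Sum>x\<in>C. \<nu> x * P h x y)"
proof -
  define ts :: "nat \<Rightarrow> real" where "ts i = (if i = 0 then 0 else if i = 1 then s else s + h)" for i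
  define Cs where "Cs i = (if i = 0 then Om else if i = 1 then C else D)" for i :: nat
  have "prob {\<omega> \<in> space M. \<forall>i\<le>2. X (ts i) \<omega> \<in> Cs i} = (\<Sum>y\<in>Cs 2. fw ts Cs 2 y)"
    by (rule prob_path) (use assms in \<open>auto simp: ts_def Cs_def\<close>)
  moreover have "{\<omega> \<in> space M. \<forall>i\<le>2. X (ts i) \<omega> \<in> Cs i} = {\<omega> \<in> space M. X s \<omega> \<in> C \<and> X (s + h) \<omega> \<in> D}"
    using X_in by (auto simp: ts_def Cs_def numeral_2_eq_2 le_Suc_eq)
  moreover have "fw ts Cs 2 y = (\<Sum>x\<in>C. \<nu> x * P h x y)" for y
    using assms nu_P by (auto simp: numeral_2_eq_2 ts_def Cs_def intro!: sum.cong)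
  ultimately show ?thesis by (simp add: Cs_def)
qed

text \<open>The start in \<open>x\<close> has positive probability \<open>\<nu> x\<close>, so a fact
  about joint probabilities may be divided by it. \<open>P_sum\<close> and
  \<open>chapman_kolmogorov\<close> follow in the same way.\<close>

lemma P_nonneg:
  assumes "h \<ge> 0" "x \<in> Om" "y \<in> Om"
  shows "P h x y \<ge> 0"
proof -
  have "\<nu> x * P h x y = prob {\<omega> \<in> space M. X 0 \<omega> \<in> {x} \<and> X (0 + h) \<omega> \<in> {y}}"
    using assms by (subst prob_two_times) auto
  then have "\<nu> x * P h x y \<ge> 0" by simp
  then show ?thesis using nu_pos[OF assms(2)] by (simp add: zero_le_mult_iff)
qed

lemma P_sum:
  assumes "h \<ge> 0" "x \<in> Om"
  shows "(\<Sum>y\<in>Om. P h x y) = 1"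
proof -
  have "(\<Sum>y\<in>Om. \<nu> x * P h x y) = prob {\<omega> \<in> space M. X 0 \<omega> \<in> {x} \<and> X (0 + h) \<omega> \<in> Om}"
    using assms by (subst prob_two_times) auto
  also have "\<dots> = prob {\<omega> \<in> space M. \<forall>i\<le>0::nat. X (0::real) \<omega> = x}"
    using X_in assms by (intro arg_cong[where f=prob]) auto
  also have "\<dots> = \<nu> x" using X_fdd[of "\<lambda>_. 0" 0 "\<lambda>_. x"] by simp
  finally have "\<nu> x * (\<Sum>y\<in>Om. P h x y) = \<nu> x" by (simp add: sum_distrib_left)
  then show ?thesis using nu_pos[OF assms(2)] by simp
qed

text \<open>One event, a start in \<open>x\<close> and a visit to \<open>y\<close> at time
  \<open>s + h\<close>, is evaluated both with and without a void observation at time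
  \<open>s\<close>.\<close>

lemma chapman_kolmogorov:
  assumes "s \<ge> 0" "h \<ge> 0" "x \<in> Om" "y \<in> Om"
  shows "P (s + h) x y = (\<Sum>z\<in>Om. P s x z * P h z y)"
proof -
  define ts :: "nat \<Rightarrow> real" where "ts i = (if i = 0 then 0 else if i = 1 then s else s + h)" for i
  define Cs where "Cs i = (if i = 0 then {x} else if i = 1 then Om else {y})" for i :: nat
  have "prob {\<omega> \<in> space M. \<forall>i\<le>2. X (ts i) \<omega> \<in> Cs i} = (\<Sum>y\<in>Cs 2. fw ts Cs 2 y)"
    by (rule prob_path) (use assms in \<open>auto simp: ts_def Cs_def\<close>)
  moreover have "{\<omega> \<in> space M. \<forall>i\<le>2. X (ts i) \<omega> \<in> Cs i} = {\<omega> \<in> space M. X 0 \<omega> \<in> {x} \<and> X (0 + (s + h)) \<omega> \<in> {y}}"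
    using X_in assms by (auto simp: ts_def Cs_def numeral_2_eq_2 le_Suc_eq)
  moreover have "prob {\<omega> \<in> space M. X 0 \<omega> \<in> {x} \<and> X (0 + (s + h)) \<omega> \<in> {y}} = \<nu> x * P (s + h) x y"
    using assms by (subst prob_two_times) auto
  moreover have "(\<Sum>y\<in>Cs 2. fw ts Cs 2 y) = \<nu> x * (\<Sum>z\<in>Om. P s x z * P h z y)"
    by (simp add: numeral_2_eq_2 ts_def Cs_def sum_distrib_left mult.assoc)
  ultimately show ?thesis using nu_pos[OF assms(3)] by simp
qed

end

section \<open>Mixing\<close>

context stationary_ctmc
begin

text \<open>The distance is the l1 norm, twice total variation. In this norm the bounds multiply
  without a constant, and the threshold 1/4 of \<open>mixing_time\<close> becomes 1/2.\<close>

definition mixed :: "real \<Rightarrow> real \<Rightarrow> bool" where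
  "mixed S D \<longleftrightarrow> S \<ge> 0 \<and> (\<forall>x\<in>Om. (\<Sum>y\<in>Om. \<bar>P S x y - \<nu> y\<bar>) \<le> D)"

text \<open>A stochastic kernel does not increase the l1 norm of a signed measure, and restricting
  the measure to \<open>C\<close> beforehand only loses mass. So an error made once does not grow
  under later constraints.\<close>

lemma sum_P_apply_le:
  assumes "h \<ge> 0" "C \<subseteq> Om"
  shows "(\<Sum>z\<in>Om. \<bar>\<Sum>y\<in>C. a y * P h y z\<bar>) \<le> (\<Sum>y\<in>Om. \<bar>a y\<bar>)"
proof -
  have "(\<Sum>z\<in>Om. \<bar>\<Sum>y\<in>C. a y * P h y z\<bar>) \<le> (\<Sum>z\<in>Om. \<Sum>y\<in>C. \<bar>a y\<bar> * P h y z)"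
    using assms P_nonneg by (intro sum_mono order_trans[OF sum_abs]) (auto simp: abs_mult intro!: sum_mono)
  also have "\<dots> = (\<Sum>y\<in>C. \<bar>a y\<bar> * (\<Sum>z\<in>Om. P h y z))"
    by (subst sum.swap) (simp add: sum_distrib_left)
  also have "\<dots> = (\<Sum>y\<in>C. \<bar>a y\<bar>)"
    using assms P_sum by (intro sum.cong) auto
  also have "\<dots> \<le> (\<Sum>y\<in>Om. \<bar>a y\<bar>)"
    using assms fin by (intro sum_mono2) auto
  finally show ?thesis .
qed

text \<open>Before the gap the constrained law has mass \<open>F\<close>; across the gap each of its
  points is spread to within \<open>D\<close> of \<open>\<nu>\<close>, so the result is within
  \<open>F * D\<close> of \<open>F * \<nu>\<close>. From there on both measures evolve under the
  same restricted kernels, the second one with its clock reset to 0.\<close>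

lemma fw_decouple:
  assumes ts: "ts 0 = 0" "\<And>i. i < k + 1 + m \<Longrightarrow> ts i \<le> ts (Suc i)" and C: "\<And>i. C i \<subseteq> Om"
    and mx: "mixed (ts (Suc k) - ts k) D"
  defines "F \<equiv> \<Sum>y\<in>C k. fw ts C k y"
  assumes "i \<le> m"
  shows "(\<Sum>z\<in>Om. \<bar>fw ts C (k + 1 + i) z
           - F * fw (\<lambda>i. ts (k + 1 + i) - ts (k + 1)) (\<lambda>i. C (k + 1 + i)) i z\<bar>) \<le> F * D"
  using \<open>i \<le> m\<close>
proof (induction i)
  case 0
  let ?S = "ts (Suc k) - ts k"
  have nn: "fw ts C k y \<ge> 0" for y by (rule fw_nonneg_path) (use ts C in auto)
  have "(\<Sum>z\<in>Om. \<bar>fw ts C (k + 1) z - F * \<nu> z\<bar>) = (\<Sum>z\<in>Om. \<bar>\<Sum>y\<in>C k. fw ts C k y * (P ?S y z - \<nu> z)\<bar>)"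
    by (simp add: F_def sum_distrib_right right_diff_distrib sum_subtractf)
  also have "\<dots> \<le> (\<Sum>z\<in>Om. \<Sum>y\<in>C k. fw ts C k y * \<bar>P ?S y z - \<nu> z\<bar>)"
    using nn by (intro sum_mono order_trans[OF sum_abs]) (simp add: abs_mult)
  also have "\<dots> = (\<Sum>y\<in>C k. fw ts C k y * (\<Sum>z\<in>Om. \<bar>P ?S y z - \<nu> z\<bar>))"
    by (subst sum.swap) (simp add: sum_distrib_left)
  also have "\<dots> \<le> (\<Sum>y\<in>C k. fw ts C k y * D)"
    using nn mx C unfolding mixed_def by (intro sum_mono mult_left_mono) blast+
  finally show ?case by (simp add: F_def sum_distrib_right)
next
  case (Suc i)
  let ?w = "fw (\<lambda>i. ts (k + 1 + i) - ts (k + 1)) (\<lambda>i. C (k + 1 + i))"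
  let ?h = "ts (Suc (k + 1 + i)) - ts (k + 1 + i)"
  have "(\<Sum>z\<in>Om. \<bar>fw ts C (k + 1 + Suc i) z - F * ?w (Suc i) z\<bar>)
      = (\<Sum>z\<in>Om. \<bar>\<Sum>y\<in>C (k + 1 + i). (fw ts C (k + 1 + i) y - F * ?w i y) * P ?h y z\<bar>)"
    by (simp add: sum_distrib_left left_diff_distrib sum_subtractf mult.assoc)
  also have "\<dots> \<le> (\<Sum>y\<in>Om. \<bar>fw ts C (k + 1 + i) y - F * ?w i y\<bar>)"
    using ts(2)[of "k + 1 + i"] Suc.prems C by (intro sum_P_apply_le) auto
  also have "\<dots> \<le> F * D" using Suc by simp
  finally show ?case .
qed

text \<open>The error keeps the probability of the first window as a factor. This is what later
  turns the estimate into geometric decay instead of a mere additive bound.\<close>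

lemma prob_decouple:
  assumes ts: "ts 0 = 0" "\<And>i. i < k + 1 + m \<Longrightarrow> ts i \<le> ts (Suc i)" and C: "\<And>i. C i \<subseteq> Om"
    and mx: "mixed (ts (Suc k) - ts k) D"
  shows "\<bar>prob {\<omega> \<in> space M. \<forall>i\<le>k + 1 + m. X (ts i) \<omega> \<in> C i}
     - prob {\<omega> \<in> space M. \<forall>i\<le>k. X (ts i) \<omega> \<in> C i} *
       prob {\<omega> \<in> space M. \<forall>i\<le>m. X (ts (k + 1 + i) - ts (k + 1)) \<omega> \<in> C (k + 1 + i)}\<bar>
     \<le> prob {\<omega> \<in> space M. \<forall>i\<le>k. X (ts i) \<omega> \<in> C i} * D"
proof -
  let ?ts = "\<lambda>i. ts (k + 1 + i) - ts (k + 1)" and ?C = "\<lambda>i. C (k + 1 + i)"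
  define F where "F = (\<Sum>y\<in>C k. fw ts C k y)"
  have 1: "prob {\<omega> \<in> space M. \<forall>i\<le>k + 1 + m. X (ts i) \<omega> \<in> C i} = (\<Sum>y\<in>C (k + 1 + m). fw ts C (k + 1 + m) y)"
    by (rule prob_path) (use ts C in auto)
  have 2: "prob {\<omega> \<in> space M. \<forall>i\<le>k. X (ts i) \<omega> \<in> C i} = F"
    unfolding F_def by (rule prob_path) (use ts C in auto)
  have 3: "prob {\<omega> \<in> space M. \<forall>i\<le>m. X (?ts i) \<omega> \<in> ?C i} = (\<Sum>y\<in>?C m. fw ?ts ?C m y)"
    by (rule prob_path) (use ts C in auto)
  have "\<bar>(\<Sum>y\<in>C (k + 1 + m). fw ts C (k + 1 + m) y) - F * (\<Sum>y\<in>?C m. fw ?ts ?C m y)\<bar>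
     = \<bar>\<Sum>y\<in>C (k + 1 + m). fw ts C (k + 1 + m) y - F * fw ?ts ?C m y\<bar>"
    by (simp only: sum_distrib_left sum_subtractf)
  also have "\<dots> \<le> (\<Sum>y\<in>C (k + 1 + m). \<bar>fw ts C (k + 1 + m) y - F * fw ?ts ?C m y\<bar>)"
    by (rule sum_abs)
  also have "\<dots> \<le> (\<Sum>y\<in>Om. \<bar>fw ts C (k + 1 + m) y - F * fw ?ts ?C m y\<bar>)"
    using C fin by (intro sum_mono2) auto
  also have "\<dots> \<le> F * D"
    unfolding F_def by (rule fw_decouple[OF ts C mx order_refl])
  finally show ?thesis unfolding 1 2 3 .
qed

text \<open>Let \<Pi> be the kernel all of whose rows are \<open>\<nu>\<close>. Row sums, invariance
  and total mass 1 make every product of \<Pi> with \<open>P\<close> or itself equal to \<Pi>, so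
  the deviation of \<open>P (s + t)\<close> from \<Pi> is the product of the deviations at
  \<open>s\<close> and at \<open>t\<close>.\<close>

lemma mixed_add:
  assumes "mixed s a" "mixed t b" "Om \<noteq> {}"
  shows "mixed (s + t) (a * b)"
  unfolding mixed_def
proof (intro conjI ballI)
  have st: "s \<ge> 0" "t \<ge> 0" using assms by (auto simp: mixed_def)
  show "s + t \<ge> 0" using st by simp
  obtain x0 where x0: "x0 \<in> Om" using assms(3) by auto
  have b0: "b \<ge> 0" using assms(2) x0 unfolding mixed_def by (meson abs_ge_zero order_trans sum_nonneg)
  fix x assume x: "x \<in> Om"
  have "P (s + t) x y - \<nu> y = (\<Sum>z\<in>Om. (P s x z - \<nu> z) * (P t z y - \<nu> y))" if "y \<in> Om" for y
  proof -
    have "(\<Sum>z\<in>Om. (P s x z - \<nu> z) * (P t z y - \<nu> y))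
       = (\<Sum>z\<in>Om. P s x z * P t z y) - (\<Sum>z\<in>Om. \<nu> z * P t z y)
         - (\<Sum>z\<in>Om. P s x z) * \<nu> y + (\<Sum>z\<in>Om. \<nu> z) * \<nu> y"
      by (simp add: algebra_simps sum.distrib sum_subtractf sum_distrib_left)
    also have "\<dots> = P (s + t) x y - \<nu> y"
      using chapman_kolmogorov[OF st x that] nu_P[OF that] P_sum[OF st(1) x] nu_sum by simp
    finally show ?thesis by simp
  qed
  then have "(\<Sum>y\<in>Om. \<bar>P (s + t) x y - \<nu> y\<bar>)
      \<le> (\<Sum>y\<in>Om. \<Sum>z\<in>Om. \<bar>P s x z - \<nu> z\<bar> * \<bar>P t z y - \<nu> y\<bar>)"
    by (intro sum_mono) (auto intro!: order_trans[OF sum_abs] simp: abs_mult)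
  also have "\<dots> = (\<Sum>z\<in>Om. \<bar>P s x z - \<nu> z\<bar> * (\<Sum>y\<in>Om. \<bar>P t z y - \<nu> y\<bar>))"
    by (subst sum.swap) (simp add: sum_distrib_left)
  also have "\<dots> \<le> (\<Sum>z\<in>Om. \<bar>P s x z - \<nu> z\<bar> * b)"
    using assms(2) unfolding mixed_def by (intro sum_mono mult_left_mono) auto
  also have "\<dots> = (\<Sum>z\<in>Om. \<bar>P s x z - \<nu> z\<bar>) * b" by (simp add: sum_distrib_right)
  also have "\<dots> \<le> a * b"
    using assms(1) x b0 unfolding mixed_def by (intro mult_right_mono) auto
  finally show "(\<Sum>y\<in>Om. \<bar>P (s + t) x y - \<nu> y\<bar>) \<le> a * b" .
qed

text \<open>The exponent starts at 1 because at time 0 the l1 distance may well exceed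
  \<open>a ^ 0 = 1\<close>.\<close>

lemma mixed_pow:
  assumes "mixed s a" "Om \<noteq> {}"
  shows "mixed (real (Suc k) * s) (a ^ Suc k)"
proof (induction k)
  case 0
  then show ?case using assms by simp
next
  case (Suc k)
  have "mixed (s + real (Suc k) * s) (a * a ^ Suc k)"
    by (rule mixed_add[OF assms(1) Suc assms(2)])
  moreover have "s + real (Suc k) * s = real (Suc (Suc k)) * s" by (simp add: algebra_simps)
  ultimately show ?case by simp
qed

section \<open>Positivity of the transition probabilities and convergence to equilibrium\<close>

lemma P_ge_mult:
  assumes "s \<ge> 0" "t \<ge> 0" "x \<in> Om" "y \<in> Om" "z \<in> Om"
  shows "P s x z * P t z y \<le> P (s + t) x y"
  unfolding chapman_kolmogorov[OF assms(1-4)]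
  using assms fin P_nonneg by (intro member_le_sum) auto

text \<open>Near time 0 the diagonal entries are close to 1, and the off-diagonal ones behave like
  \<open>R x y * h\<close>.\<close>

lemma eventually_P_pos:
  assumes "x \<in> Om" "y \<in> Om" "x = y \<or> R x y > 0"
  shows "eventually (\<lambda>h. P h x y > 0) (at_right 0)"
proof (cases "x = y")
  case True
  have "isCont (\<lambda>t. P t x y) 0" using DERIV_trans_fun_0[OF fin assms(1,2)] by (rule DERIV_isCont)
  then have "((\<lambda>t. P t x y) \<longlongrightarrow> 1) (at_right 0)"
    using True unfolding isCont_def trans_fun_0 by (auto intro: tendsto_within_subset)
  then show ?thesis by (rule order_tendstoD) simp
next
  case False
  have "((\<lambda>h. (P (0 + h) x y - P 0 x y) / h) \<longlongrightarrow> generator Om R x y) (at 0)"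
    using DERIV_trans_fun_0[OF fin assms(1,2)] by (rule DERIV_D)
  then have "((\<lambda>h. P h x y / h) \<longlongrightarrow> R x y) (at_right 0)"
    using False assms by (auto simp: trans_fun_0 generator_def intro: tendsto_within_subset)
  then have "eventually (\<lambda>h. P h x y / h > 0) (at_right 0)"
    using assms False by (intro order_tendstoD) auto
  moreover have "eventually (\<lambda>h::real. h > 0) (at_right 0)"
    by (simp add: eventually_at_right_less)
  ultimately show ?thesis by eventually_elim (simp add: zero_less_divide_iff)
qed

text \<open>For one small \<open>h\<close>, every allowed jump and every stay has positive
  probability within time \<open>h\<close>. A path of jumps gives each pair its own multiple of
  \<open>h\<close>; since staying is possible, the multiples can be raised to a common one, and no
  periodicity can interfere.\<close>

lemma exists_P_pos: "\<exists>T>0. \<forall>x\<in>Om. \<forall>y\<in>Om. P T x y > 0"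
proof -
  let ?E = "{(u, v). u \<in> Om \<and> v \<in> Om \<and> u \<noteq> v \<and> R u v > 0}"
  have "eventually (\<lambda>h. \<forall>x\<in>Om. \<forall>y\<in>Om. x = y \<or> R x y > 0 \<longrightarrow> P h x y > 0) (at_right 0)"
  proof (intro eventually_ball_finite fin ballI)
    fix x y assume "x \<in> Om" "y \<in> Om"
    then show "eventually (\<lambda>h. x = y \<or> R x y > 0 \<longrightarrow> P h x y > 0) (at_right 0)"
      using eventually_P_pos[of x y] by (cases "x = y \<or> R x y > 0") (auto elim: eventually_mono)
  qed
  moreover have "eventually (\<lambda>h::real. h > 0) (at_right 0)"
    by (simp add: eventually_at_right_less)
  ultimately have "eventually (\<lambda>h. h > 0 \<and> (\<forall>x\<in>Om. \<forall>y\<in>Om. x = y \<or> R x y > 0 \<longrightarrow> P h x y > 0)) (at_right 0)"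
    by eventually_elim auto
  then obtain h where h: "h > 0" "\<And>x y. x \<in> Om \<Longrightarrow> y \<in> Om \<Longrightarrow> x = y \<or> R x y > 0 \<Longrightarrow> P h x y > 0"
    using eventually_happens'[OF trivial_limit_at_right_real] by blast
  have stay: "P (real m * h) x y > 0" if "P (real n * h) x y > 0" "x \<in> Om" "y \<in> Om" "n \<le> m" for n m x y
    using \<open>n \<le> m\<close>
  proof (induction m rule: dec_induct)
    case base
    then show ?case using that by simp
  next
    case (step m)
    have "0 < P (real m * h) x y * P h y y" using step.IH h(2)[of y y] that by simp
    also have "\<dots> \<le> P (real m * h + h) x y" using that h(1) by (intro P_ge_mult) auto
    finally show ?case by (simp add: algebra_simps)
  qed
  have "\<exists>n. P (real n * h) x y > 0" if "(x, y) \<in> ?E\<^sup>*" "x \<in> Om" for x y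
    using that(1)
  proof (induction rule: rtrancl_induct)
    case base
    show ?case by (rule exI[of _ 0]) (simp add: trans_fun_0)
  next
    case (step y z)
    then obtain n where n: "P (real n * h) x y > 0" by auto
    have "0 < P (real n * h) x y * P h y z" using n h(2)[of y z] step.hyps by simp
    also have "\<dots> \<le> P (real n * h + h) x z" using step.hyps that(2) h(1) by (intro P_ge_mult) auto
    finally show ?case by (intro exI[of _ "Suc n"]) (simp add: algebra_simps)
  qed
  then have "\<forall>p\<in>Om\<times>Om. \<exists>n. P (real n * h) (fst p) (snd p) > 0"
    using irred unfolding irreducible_chain_def by auto
  then obtain n where n: "\<And>x y. x \<in> Om \<Longrightarrow> y \<in> Om \<Longrightarrow> P (real (n (x, y)) * h) x y > 0"
    by (metis mem_Sigma_iff fst_conv snd_conv)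
  \<comment> \<open>The sum over all pairs dominates each \<open>n (x, y)\<close>;
    \<open>Suc\<close> keeps the time positive even if all of them are 0.\<close>
  define m where "m = Suc (\<Sum>p\<in>Om\<times>Om. n p)"
  have "n (x, y) \<le> m" if "x \<in> Om" "y \<in> Om" for x y
    using member_le_sum[of "(x, y)" "Om\<times>Om" n] that fin unfolding m_def by auto
  then have "P (real m * h) x y > 0" if "x \<in> Om" "y \<in> Om" for x y
    using stay[OF n] that by blast
  moreover have "m > 0" by (simp add: m_def)
  then have "real m * h > 0" using h(1) by simp
  ultimately show ?thesis by blast
qed

text \<open>Doeblin's argument: a zero-sum signed measure loses the fraction \<open>\<epsilon>\<close> of its mass
  when transported by a kernel that dominates \<open>\<epsilon> \<nu>\<close>.\<close>

lemma exists_mixed_half: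
  assumes "Om \<noteq> {}"
  shows "\<exists>T>0. mixed T (1/2)"
proof -
  obtain T where T: "T > 0" "\<And>x y. x \<in> Om \<Longrightarrow> y \<in> Om \<Longrightarrow> P T x y > 0"
    using exists_P_pos by blast
  \<comment> \<open>The smallest entry of \<open>P T\<close>. Because \<open>\<nu> y\<close> is at
    most 1, it also serves as the Doeblin constant in front of \<open>\<nu>\<close>.\<close>
  define e where "e = Min ((\<lambda>(x, y). P T x y) ` (Om \<times> Om))"
  have ne: "finite ((\<lambda>(x, y). P T x y) ` (Om \<times> Om))" "(\<lambda>(x, y). P T x y) ` (Om \<times> Om) \<noteq> {}"
    using fin assms by auto
  have e0: "e > 0" unfolding e_def Min_gr_iff[OF ne] using T by auto
  have nu1: "\<nu> y \<le> 1" if "y \<in> Om" for y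
    using member_le_sum[OF that, of \<nu>] nu_nonneg fin nu_sum by simp
  have e: "P T x y \<ge> e * \<nu> y" if "x \<in> Om" "y \<in> Om" for x y
  proof -
    have "e * \<nu> y \<le> e * 1" using nu1[OF that(2)] e0 by (intro mult_left_mono) auto
    also have "\<dots> \<le> P T x y"
      unfolding e_def using that Min_le[OF ne(1), of "P T x y"] by force
    finally show ?thesis .
  qed
  obtain x0 where x0: "x0 \<in> Om" using assms by auto
  have e1: "e \<le> 1"
  proof -
    have "e = (\<Sum>y\<in>Om. e * \<nu> y)" using nu_sum by (simp flip: sum_distrib_left)
    also have "\<dots> \<le> (\<Sum>y\<in>Om. P T x0 y)" using e x0 by (intro sum_mono) auto
    finally show ?thesis using P_sum[of T x0] T x0 by simp
  qed
  have contract: "(\<Sum>y\<in>Om. \<bar>P (s + T) x y - \<nu> y\<bar>) \<le> (1 - e) * (\<Sum>y\<in>Om. \<bar>P s x y - \<nu> y\<bar>)"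
    if s: "s \<ge> 0" and x: "x \<in> Om" for s x
  proof -
    \<comment> \<open>The subtracted term \<open>e * \<nu> y\<close> does not depend on
      \<open>z\<close>, so it is cancelled by the zero total mass of the first factor; what remains
      is a nonnegative kernel with row sums \<open>1 - e\<close>.\<close>
    have "P (s + T) x y - \<nu> y = (\<Sum>z\<in>Om. (P s x z - \<nu> z) * (P T z y - e * \<nu> y))" if "y \<in> Om" for y
    proof -
      have "(\<Sum>z\<in>Om. (P s x z - \<nu> z) * (P T z y - e * \<nu> y))
         = (\<Sum>z\<in>Om. P s x z * P T z y) - (\<Sum>z\<in>Om. \<nu> z * P T z y)
           - (\<Sum>z\<in>Om. P s x z) * (e * \<nu> y) + (\<Sum>z\<in>Om. \<nu> z) * (e * \<nu> y)"
        by (simp add: algebra_simps sum.distrib sum_subtractf sum_distrib_left)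
      also have "\<dots> = P (s + T) x y - \<nu> y"
        using chapman_kolmogorov[OF s _ x that, of T] nu_P[OF that] P_sum[OF s x] nu_sum T(1) by simp
      finally show ?thesis by simp
    qed
    then have "(\<Sum>y\<in>Om. \<bar>P (s + T) x y - \<nu> y\<bar>)
        \<le> (\<Sum>y\<in>Om. \<Sum>z\<in>Om. \<bar>P s x z - \<nu> z\<bar> * (P T z y - e * \<nu> y))"
      using e by (intro sum_mono) (auto intro!: order_trans[OF sum_abs] sum_mono simp: abs_mult)
    also have "\<dots> = (\<Sum>z\<in>Om. \<bar>P s x z - \<nu> z\<bar> * (\<Sum>y\<in>Om. P T z y - e * \<nu> y))"
      by (subst sum.swap) (simp add: sum_distrib_left)
    also have "\<dots> = (\<Sum>z\<in>Om. \<bar>P s x z - \<nu> z\<bar> * (1 - e))"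
      using P_sum T(1) nu_sum by (intro sum.cong) (auto simp: sum_subtractf simp flip: sum_distrib_left)
    finally show ?thesis by (simp add: sum_distrib_left mult.commute)
  qed
  have iter: "(\<Sum>y\<in>Om. \<bar>P (real n * T) x y - \<nu> y\<bar>) \<le> (1 - e) ^ n * 2" if x: "x \<in> Om" for n x
  proof (induction n)
    case 0
    have "(\<Sum>y\<in>Om. \<bar>P 0 x y - \<nu> y\<bar>) \<le> (\<Sum>y\<in>Om. P 0 x y + \<nu> y)"
      using P_nonneg[OF order_refl x] nu_nonneg by (intro sum_mono abs_leI) (auto simp: add_nonneg_nonneg)
    then show ?case using P_sum[OF order_refl x] nu_sum by (simp add: sum.distrib)
  next
    case (Suc n)
    have "(\<Sum>y\<in>Om. \<bar>P (real n * T + T) x y - \<nu> y\<bar>) \<le> (1 - e) * (\<Sum>y\<in>Om. \<bar>P (real n * T) x y - \<nu> y\<bar>)"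
      using T x by (intro contract) auto
    also have "\<dots> \<le> (1 - e) * ((1 - e) ^ n * 2)" using Suc e1 by (intro mult_left_mono) auto
    finally show ?case by (simp add: algebra_simps)
  qed
  have "(\<lambda>n. (1 - e) ^ n * 2) \<longlonglongrightarrow> 0"
    using e0 e1 by (intro tendsto_mult_left_zero LIMSEQ_power_zero) auto
  then have "eventually (\<lambda>n. (1 - e) ^ n * 2 < 1/2) sequentially"
    by (rule order_tendstoD) simp
  then have "eventually (\<lambda>n. (1 - e) ^ n * 2 < 1/2 \<and> n > 0) sequentially"
    using eventually_gt_at_top[of 0] by eventually_elim simp
  then obtain n where n: "(1 - e) ^ n * 2 < 1/2" "n > 0" using eventually_happens'[OF sequentially_bot] by blast
  then have "mixed (real n * T) (1/2)"
    using iter[of _ n] T unfolding mixed_def by fastforce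
  then show ?thesis using n T by (intro exI[of _ "real n * T"]) auto
qed

text \<open>The slack \<open>e\<close> avoids the question whether the infimum is attained;
  \<open>exists_mixed_half\<close> ensures that it is taken over a nonempty set.\<close>

lemma exists_mixed_near_mixing_time:
  assumes "Om \<noteq> {}" "e > 0"
  shows "\<exists>T>0. mixed T (1/2) \<and> T < mixing_time Om R \<nu> + e"
proof -
  let ?S = "{t. t > 0 \<and> (\<forall>\<eta>\<in>Om. tv_dist Om (P t \<eta>) \<nu> \<le> 1/4)}"
  have iff: "t \<in> ?S \<longleftrightarrow> t > 0 \<and> mixed t (1/2)" for t
    unfolding mixed_def tv_dist_def by auto
  then have "?S \<noteq> {}" using exists_mixed_half[OF assms(1)] by blast
  moreover have "bdd_below ?S" by (rule bdd_belowI[of _ 0]) auto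
  ultimately obtain T where "T \<in> ?S" "T < Inf ?S + e"
    using cInf_lessD[of ?S "Inf ?S + e"] assms(2) by auto
  then show ?thesis using iff unfolding mixing_time_def by blast
qed

end

section \<open>Avoiding a set\<close>

text \<open>Positivity of the rate forces both \<open>A\<close> and its complement in
  \<open>Om\<close> to be nonempty.\<close>

locale stationary_ctmc_hitting = stationary_ctmc M Om R \<nu> X
  for M :: "'b measure" and Om :: "'a set" and R \<nu> X +
  fixes A :: "'a set"
  assumes A_sub: "A \<subseteq> Om"
    and r_pos: "rate_into Om R \<nu> A > 0"
begin

abbreviation "r \<equiv> rate_into Om R \<nu> A"

text \<open>The window contains its left endpoint although \<open>hitting_time\<close> looks at
  positive times only: by right continuity a path that starts in \<open>A\<close> is also in
  \<open>A\<close> at arbitrarily small positive times.\<close>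

definition avoids :: "real \<Rightarrow> real \<Rightarrow> 'b set" where
  "avoids u t = {\<omega> \<in> space M. \<forall>s\<in>{u..u + t}. X s \<omega> \<notin> A}"

text \<open>Dyadic spacing makes each grid contain the previous one, so the events decrease in
  \<open>n\<close> and their probabilities converge to that of the intersection.\<close>

definition avoids_grid :: "real \<Rightarrow> real \<Rightarrow> nat \<Rightarrow> 'b set" where
  "avoids_grid u t n = {\<omega> \<in> space M. \<forall>i\<le>2 ^ n. X (u + t * real i / 2 ^ n) \<omega> \<notin> A}"

definition survival :: "real \<Rightarrow> real" where
  "survival t = prob (avoids 0 t)"

lemma avoids_grid_sets:
  assumes "u \<ge> 0" "t \<ge> 0"
  shows "avoids_grid u t n \<in> sets M"
proof -
  have "avoids_grid u t n = {\<omega> \<in> space M. \<forall>i\<in>{..2 ^ n}. X (u + t * real i / 2 ^ n) \<omega> \<in> - A}"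
    unfolding avoids_grid_def by auto
  also have "\<dots> \<in> sets M" using assms by (intro X_sets_ball) auto
  finally show ?thesis .
qed

lemma decseq_avoids_grid: "decseq (avoids_grid u t)"
proof (rule decseq_SucI, rule subsetI)
  fix n \<omega> assume w: "\<omega> \<in> avoids_grid u t (Suc n)"
  have "X (u + t * real i / 2 ^ n) \<omega> \<notin> A" if "i \<le> 2 ^ n" for i
  proof -
    have "X (u + t * real (2 * i) / 2 ^ Suc n) \<omega> \<notin> A"
      using w that unfolding avoids_grid_def by (metis (mono_tags, lifting) mem_Collect_eq mult_le_mono2 power_Suc)
    then show ?thesis by simp
  qed
  then show "\<omega> \<in> avoids_grid u t n" using w by (simp add: avoids_grid_def)
qed

text \<open>Paths are right continuous, so avoiding \<open>A\<close> on all dyadic points (with the right endpoint)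
  means avoiding \<open>A\<close> throughout.\<close>

lemma INT_avoids_grid:
  assumes "u \<ge> 0" "t \<ge> 0"
  shows "(\<Inter>n. avoids_grid u t n) = avoids u t"
proof (intro equalityI subsetI)
  fix \<omega> assume "\<omega> \<in> avoids u t"
  moreover have "u + t * real i / 2 ^ n \<in> {u..u + t}" if "i \<le> 2 ^ n" for i n
  proof -
    have "real i / 2 ^ n \<le> 1" using that by simp
    then have "t * (real i / 2 ^ n) \<le> t * 1" using assms by (intro mult_left_mono) auto
    then show ?thesis using assms by simp
  qed
  ultimately show "\<omega> \<in> (\<Inter>n. avoids_grid u t n)"
    unfolding avoids_def avoids_grid_def by blast
next
  fix \<omega> assume w: "\<omega> \<in> (\<Inter>n. avoids_grid u t n)"
  then have sp: "\<omega> \<in> space M" by (auto simp: avoids_grid_def)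
  have g: "X (u + t * real i / 2 ^ n) \<omega> \<notin> A" if "i \<le> 2 ^ n" for i n
    using w that by (auto simp: avoids_grid_def)
  have "X s \<omega> \<notin> A" if s: "s \<in> {u..u + t}" for s
  proof (cases "s = u + t")
    case True
    then show ?thesis using g[of 1 0] by simp
  next
    case False
    then have lt: "s < u + t" "t > 0" "s \<ge> u" using s by auto
    obtain e where e: "e > 0" "\<And>v. s \<le> v \<Longrightarrow> v < s + e \<Longrightarrow> X v \<omega> = X s \<omega>"
      using X_right_cont[OF sp order_trans[OF assms(1) lt(3)]] by blast
    \<comment> \<open>The first bound keeps a point to the right of \<open>s\<close> in the interval
      on which the path is constant, the second keeps it inside the window.\<close>
    define d where "d = min e (u + t - s)"
    have d: "d > 0" using e lt by (simp add: d_def)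
    obtain n :: nat where "t / d < 2 ^ n" using real_arch_pow[of 2 "t / d"] by auto
    then have n: "t / 2 ^ n < d" using d by (simp add: field_simps)
    \<comment> \<open>The first grid index whose time is at or after \<open>s\<close>; the mesh is
      below \<open>d\<close>, so that time lies before \<open>s + d\<close>.\<close>
    define i where "i = nat \<lceil>(s - u) * 2 ^ n / t\<rceil>"
    have i: "real i = of_int \<lceil>(s - u) * 2 ^ n / t\<rceil>"
      unfolding i_def using lt by simp
    have ge: "real i \<ge> (s - u) * 2 ^ n / t" and le: "real i < (s - u) * 2 ^ n / t + 1"
      unfolding i by linarith+
    have 1: "s \<le> u + t * real i / 2 ^ n" using ge lt by (simp add: field_simps)
    have "t * real i / 2 ^ n < t * ((s - u) * 2 ^ n / t + 1) / 2 ^ n"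
      using le lt by (intro divide_strict_right_mono mult_strict_left_mono) auto
    also have "\<dots> = s - u + t / 2 ^ n" using lt by (simp add: field_simps)
    finally have 2: "u + t * real i / 2 ^ n < s + d" using n by simp
    then have "t * real i / 2 ^ n < t" unfolding d_def by linarith
    then have "real i < 2 ^ n" using lt by (simp add: field_simps)
    then have "i \<le> 2 ^ n" by (metis less_imp_le_nat of_nat_less_iff of_nat_numeral of_nat_power)
    then have "X (u + t * real i / 2 ^ n) \<omega> \<notin> A" by (rule g)
    moreover have "X (u + t * real i / 2 ^ n) \<omega> = X s \<omega>"
      using 1 2 by (intro e) (auto simp: d_def)
    ultimately show ?thesis by simp
  qed
  then show "\<omega> \<in> avoids u t" using sp by (simp add: avoids_def)
qed

lemma avoids_sets: "u \<ge> 0 \<Longrightarrow> t \<ge> 0 \<Longrightarrow> avoids u t \<in> sets M"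
  unfolding INT_avoids_grid[symmetric] by (intro sets.countable_INT) (auto simp: avoids_grid_sets)

lemma prob_avoids_grid_lim:
  assumes "u \<ge> 0" "t \<ge> 0"
  shows "(\<lambda>n. prob (avoids_grid u t n)) \<longlonglongrightarrow> prob (avoids u t)"
  using finite_Lim_measure_decseq[of "avoids_grid u t"] decseq_avoids_grid[of u t]
    avoids_grid_sets[OF assms] INT_avoids_grid[OF assms] by auto

lemma prob_avoids_grid_Int_lim:
  assumes "u \<ge> 0" "t \<ge> 0" "v \<ge> 0" "s \<ge> 0"
  shows "(\<lambda>n. prob (avoids_grid u t n \<inter> avoids_grid v s n)) \<longlonglongrightarrow> prob (avoids u t \<inter> avoids v s)"
proof -
  have "(\<lambda>n. prob (avoids_grid u t n \<inter> avoids_grid v s n))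
     \<longlonglongrightarrow> prob (\<Inter>n. avoids_grid u t n \<inter> avoids_grid v s n)"
  proof (rule finite_Lim_measure_decseq)
    show "range (\<lambda>n. avoids_grid u t n \<inter> avoids_grid v s n) \<subseteq> sets M"
      using avoids_grid_sets assms by auto
    show "decseq (\<lambda>n. avoids_grid u t n \<inter> avoids_grid v s n)"
      using decseq_avoids_grid[of u t] decseq_avoids_grid[of v s] unfolding decseq_def by blast
  qed
  also have "(\<Inter>n. avoids_grid u t n \<inter> avoids_grid v s n) = avoids u t \<inter> avoids v s"
    unfolding INT_avoids_grid[OF assms(1,2), symmetric] INT_avoids_grid[OF assms(3,4), symmetric] by blast
  finally show ?thesis .
qed

lemma prob_avoids_grid_decouple:
  assumes "t \<ge> 0" "s \<ge> 0" "mixed S D"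
  shows "\<bar>prob (avoids_grid 0 t n \<inter> avoids_grid (t + S) s n)
           - prob (avoids_grid 0 t n) * prob (avoids_grid 0 s n)\<bar>
         \<le> prob (avoids_grid 0 t n) * D"
proof -
  define k :: nat where "k = 2 ^ n"
  have k0: "k > 0" and kr: "(2::real) ^ n = real k" by (auto simp: k_def)
  \<comment> \<open>The two grids of \<open>k + 1\<close> points each are strung together: indices
    \<open>0..k\<close> run through the first window, the next \<open>k + 1\<close> indices through
    the second, and the single step from \<open>k\<close> to \<open>k + 1\<close> is the gap
    \<open>S\<close>.\<close>
  define ts where "ts i = (if i \<le> k then t * real i / 2 ^ n else t + S + s * real (i - (k + 1)) / 2 ^ n)" for i
  have S: "S \<ge> 0" using assms by (simp add: mixed_def)
  have tk: "ts k = t" "ts (Suc k) = t + S" using k0 by (auto simp: ts_def kr)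
  have mono: "ts i \<le> ts (Suc i)" for i
  proof (rule linorder_cases[of i k])
    assume "i < k"
    then show ?thesis using assms by (auto simp: ts_def intro!: divide_right_mono mult_left_mono)
  next
    assume "i = k"
    then show ?thesis using tk S by simp
  next
    assume "i > k"
    then show ?thesis using assms by (auto simp: ts_def intro!: divide_right_mono mult_left_mono)
  qed
  have 1: "{\<omega> \<in> space M. \<forall>i\<le>k. X (ts i) \<omega> \<in> Om - A} = avoids_grid 0 t n"
    using X_in assms unfolding avoids_grid_def k_def[symmetric] by (auto simp: ts_def)
  have 2: "{\<omega> \<in> space M. \<forall>i\<le>k. X (ts (k + 1 + i) - ts (k + 1)) \<omega> \<in> Om - A} = avoids_grid 0 s n"
    using X_in assms unfolding avoids_grid_def k_def[symmetric] by (auto simp: ts_def)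
  have 3: "{\<omega> \<in> space M. \<forall>i\<le>k + 1 + k. X (ts i) \<omega> \<in> Om - A} = avoids_grid 0 t n \<inter> avoids_grid (t + S) s n"
  proof -
    have split: "(\<forall>i\<le>k + 1 + k. Q i) \<longleftrightarrow> (\<forall>i\<le>k. Q i) \<and> (\<forall>i\<le>k. Q (k + 1 + i))" for Q
    proof (intro iffI conjI allI impI)
      fix i assume h: "(\<forall>i\<le>k. Q i) \<and> (\<forall>i\<le>k. Q (k + 1 + i))" "i \<le> k + 1 + k"
      show "Q i"
      proof (cases "i \<le> k")
        case False
        then have "i = k + 1 + (i - (k + 1))" "i - (k + 1) \<le> k" using h by auto
        then show ?thesis using h by metis
      qed (use h in auto)
    qed auto
    have "{\<omega> \<in> space M. \<forall>i\<le>k + 1 + k. X (ts i) \<omega> \<in> Om - A} =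
       {\<omega> \<in> space M. \<forall>i\<le>k. X (ts i) \<omega> \<in> Om - A} \<inter> {\<omega> \<in> space M. \<forall>i\<le>k. X (ts (k + 1 + i)) \<omega> \<in> Om - A}"
      unfolding split by blast
    also have "{\<omega> \<in> space M. \<forall>i\<le>k. X (ts (k + 1 + i)) \<omega> \<in> Om - A} = avoids_grid (t + S) s n"
      using X_in assms S unfolding avoids_grid_def k_def[symmetric] by (auto simp: ts_def)
    finally show ?thesis using 1 by simp
  qed
  have "ts 0 = 0" by (simp add: ts_def)
  then show ?thesis
    using prob_decouple[of ts k k "\<lambda>_. Om - A" D] mono tk assms(3) unfolding 1 2 3 by auto
qed

lemma prob_avoids_decouple:
  assumes "t \<ge> 0" "s \<ge> 0" "mixed S D"
  shows "\<bar>prob (avoids 0 t \<inter> avoids (t + S) s) - survival t * survival s\<bar> \<le> survival t * D"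
proof (rule LIMSEQ_le)
  have S: "S \<ge> 0" using assms by (simp add: mixed_def)
  show "(\<lambda>n. \<bar>prob (avoids_grid 0 t n \<inter> avoids_grid (t + S) s n)
           - prob (avoids_grid 0 t n) * prob (avoids_grid 0 s n)\<bar>)
    \<longlonglongrightarrow> \<bar>prob (avoids 0 t \<inter> avoids (t + S) s) - survival t * survival s\<bar>"
    unfolding survival_def using assms S
    by (intro tendsto_intros prob_avoids_grid_lim prob_avoids_grid_Int_lim) auto
  show "(\<lambda>n. prob (avoids_grid 0 t n) * D) \<longlonglongrightarrow> survival t * D"
    unfolding survival_def using assms by (intro tendsto_intros prob_avoids_grid_lim) auto
qed (use prob_avoids_grid_decouple[OF assms] in blast)

section \<open>The probability of entering the set during a window\<close>

lemma nu_complement: "0 < (\<Sum>x\<in>Om - A. \<nu> x)" "(\<Sum>x\<in>Om - A. \<nu> x) \<le> 1"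
proof -
  have "Om - A \<noteq> {}"
  proof
    assume "Om - A = {}"
    then show False using r_pos unfolding rate_into_def by (simp only: sum.empty mult_zero_right)
  qed
  then show "0 < (\<Sum>x\<in>Om - A. \<nu> x)" using fin nu_pos by (intro sum_pos) auto
  have "(\<Sum>x\<in>Om - A. \<nu> x) \<le> (\<Sum>x\<in>Om. \<nu> x)" using fin nu_nonneg by (intro sum_mono2) auto
  then show "(\<Sum>x\<in>Om - A. \<nu> x) \<le> 1" using nu_sum by simp
qed

text \<open>\<open>r\<close> is the stationary flux into \<open>A\<close> divided by the mass of the
  complement, which is at most 1.\<close>

lemma flux_le_r: "(\<Sum>x\<in>Om - A. \<nu> x * (\<Sum>y\<in>A. R x y)) \<le> r"
proof -
  have "(\<Sum>x\<in>Om - A. \<nu> x * (\<Sum>y\<in>A. R x y)) = (\<Sum>x\<in>Om - A. \<nu> x) * r"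
    using nu_complement unfolding rate_into_def by simp
  also have "\<dots> \<le> 1 * r" using nu_complement r_pos by (intro mult_right_mono) auto
  finally show ?thesis by simp
qed

text \<open>A path outside \<open>A\<close> at the first grid time and inside at a later one must
  cross between two consecutive grid times. By stationarity all \<open>2 ^ n\<close> crossings are
  equally likely, and the union bound adds them up.\<close>

lemma prob_enter_grid_le:
  assumes "t \<ge> 0" "h \<ge> 0"
  shows "prob ({\<omega> \<in> space M. X t \<omega> \<notin> A} - avoids_grid t h n)
     \<le> 2 ^ n * (\<Sum>x\<in>Om - A. \<nu> x * (\<Sum>y\<in>A. P (h / 2 ^ n) x y))"
proof -
  define d where "d = h / 2 ^ n"
  have d: "d \<ge> 0" using assms by (simp add: d_def)
  let ?E = "\<lambda>i. {\<omega> \<in> space M. X (t + real i * d) \<omega> \<in> Om - A \<and> X (t + real i * d + d) \<omega> \<in> A}"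
  have sub: "{\<omega> \<in> space M. X t \<omega> \<notin> A} - avoids_grid t h n \<subseteq> (\<Union>i\<in>{..<2 ^ n}. ?E i)"
  proof
    fix \<omega> assume w: "\<omega> \<in> {\<omega> \<in> space M. X t \<omega> \<notin> A} - avoids_grid t h n"
    have "\<exists>i. i \<le> 2 ^ n \<and> X (t + real i * d) \<omega> \<in> A"
      using w unfolding avoids_grid_def d_def by (auto simp: mult.commute)
    define j where "j = (LEAST i. i \<le> 2 ^ n \<and> X (t + real i * d) \<omega> \<in> A)"
    have j: "j \<le> 2 ^ n" "X (t + real j * d) \<omega> \<in> A"
      using LeastI_ex[OF \<open>\<exists>i. _ i\<close>] unfolding j_def by auto
    have "j \<noteq> 0" using j w by (auto intro: ccontr)
    then obtain i where i: "j = Suc i" by (cases j) auto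
    have "\<not> (i \<le> 2 ^ n \<and> X (t + real i * d) \<omega> \<in> A)"
      using not_less_Least[of i "\<lambda>i. i \<le> 2 ^ n \<and> X (t + real i * d) \<omega> \<in> A"] i unfolding j_def by auto
    then have "\<omega> \<in> ?E i" using i j w X_in[of \<omega> "t + real i * d"] assms d by (auto simp: algebra_simps)
    then show "\<omega> \<in> (\<Union>i\<in>{..<2 ^ n}. ?E i)" using i j by (intro UN_I[of i]) auto
  qed
  have meas: "?E i \<in> sets M" for i
    using assms d by (intro sets.sets_Collect_conj X_sets) auto
  have "prob ({\<omega> \<in> space M. X t \<omega> \<notin> A} - avoids_grid t h n) \<le> prob (\<Union>i\<in>{..<2 ^ n}. ?E i)"
    by (intro finite_measure_mono sub sets.finite_UN finite_lessThan meas)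
  also have "\<dots> \<le> (\<Sum>i<2 ^ n. prob (?E i))"
    by (intro finite_measure_subadditive_finite image_subsetI meas finite_lessThan)
  also have "\<dots> = (\<Sum>i<(2::nat) ^ n. \<Sum>x\<in>Om - A. \<nu> x * (\<Sum>y\<in>A. P d x y))"
  proof (rule sum.cong[OF refl])
    fix i :: nat
    have "prob (?E i) = (\<Sum>y\<in>A. \<Sum>x\<in>Om - A. \<nu> x * P d x y)"
      using assms d A_sub by (intro prob_two_times) auto
    then show "prob (?E i) = (\<Sum>x\<in>Om - A. \<nu> x * (\<Sum>y\<in>A. P d x y))"
      by (simp only: sum_distrib_left sum.swap[of _ A "Om - A"])
  qed
  also have "\<dots> = 2 ^ n * (\<Sum>x\<in>Om - A. \<nu> x * (\<Sum>y\<in>A. P d x y))" by simp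
  finally show ?thesis unfolding d_def .
qed

text \<open>As the mesh shrinks, \<open>2 ^ n * P (h / 2 ^ n) x y\<close> tends to
  \<open>R x y * h\<close>, so the union bound over the grid converges to the flux times
  \<open>h\<close>. The difference quotient needs nonzero steps, whence the separate case
  \<open>h = 0\<close>.\<close>

lemma prob_enter_le:
  assumes "t \<ge> 0" "h \<ge> 0"
  shows "prob ({\<omega> \<in> space M. X t \<omega> \<notin> A} - avoids t h) \<le> r * h"
proof (cases "h = 0")
  case True
  then have "{\<omega> \<in> space M. X t \<omega> \<notin> A} - avoids t h = {}" by (auto simp: avoids_def)
  then have "prob ({\<omega> \<in> space M. X t \<omega> \<notin> A} - avoids t h) = 0" by (simp only: measure_empty)
  then show ?thesis using True by simp
next
  case False
  then have h: "h > 0" using assms by simp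
  have xt: "{\<omega> \<in> space M. X t \<omega> \<notin> A} \<in> sets M" using X_sets[OF assms(1), of "- A"] by simp
  have 1: "(\<lambda>n. prob ({\<omega> \<in> space M. X t \<omega> \<notin> A} - avoids_grid t h n))
     \<longlonglongrightarrow> prob ({\<omega> \<in> space M. X t \<omega> \<notin> A} - avoids t h)"
  proof -
    have "avoids t h \<subseteq> {\<omega> \<in> space M. X t \<omega> \<notin> A}" using assms by (auto simp: avoids_def)
    then have "prob ({\<omega> \<in> space M. X t \<omega> \<notin> A} - avoids t h) = prob {\<omega> \<in> space M. X t \<omega> \<notin> A} - prob (avoids t h)"
      using finite_measure_Diff[OF xt avoids_sets[OF assms]] by blast
    moreover have "avoids_grid t h n \<subseteq> {\<omega> \<in> space M. X t \<omega> \<notin> A}" for n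
      unfolding avoids_grid_def by (auto dest: spec[of _ 0])
    then have "prob ({\<omega> \<in> space M. X t \<omega> \<notin> A} - avoids_grid t h n) =
        prob {\<omega> \<in> space M. X t \<omega> \<notin> A} - prob (avoids_grid t h n)" for n
      using finite_measure_Diff[OF xt avoids_grid_sets[OF assms]] by blast
    ultimately show ?thesis using prob_avoids_grid_lim[OF assms] by (auto intro!: tendsto_intros)
  qed
  have 2: "(\<lambda>n. 2 ^ n * (\<Sum>x\<in>Om - A. \<nu> x * (\<Sum>y\<in>A. P (h / 2 ^ n) x y)))
      \<longlonglongrightarrow> (\<Sum>x\<in>Om - A. \<nu> x * (\<Sum>y\<in>A. R x y * h))"
  proof -
    have "(\<lambda>n. 2 ^ n * P (h / 2 ^ n) x y) \<longlonglongrightarrow> R x y * h" if "x \<in> Om - A" "y \<in> A" for x y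
    proof -
      have xy: "x \<in> Om" "y \<in> Om" "x \<noteq> y" using that A_sub by auto
      have "((\<lambda>h. (P (0 + h) x y - P 0 x y) / h) \<longlongrightarrow> generator Om R x y) (at 0)"
        using DERIV_trans_fun_0[OF fin xy(1,2)] by (rule DERIV_D)
      then have "((\<lambda>h. P h x y / h) \<longlongrightarrow> R x y) (at 0)"
        using xy by (simp add: trans_fun_0 generator_def)
      moreover have "filterlim (\<lambda>n. h / 2 ^ n) (at 0) sequentially"
      proof -
        have "(\<lambda>n. h * (1 / 2) ^ n) \<longlonglongrightarrow> 0"
          by (intro tendsto_mult_right_zero LIMSEQ_power_zero) simp
        moreover have "h * (1 / 2) ^ n = h / 2 ^ n" for n by (simp add: power_divide)
        ultimately show ?thesis using h by (simp add: filterlim_at)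
      qed
      ultimately have "(\<lambda>n. P (h / 2 ^ n) x y / (h / 2 ^ n)) \<longlonglongrightarrow> R x y"
        by (rule filterlim_compose)
      then have "(\<lambda>n. P (h / 2 ^ n) x y / (h / 2 ^ n) * h) \<longlonglongrightarrow> R x y * h"
        by (intro tendsto_intros)
      then show ?thesis using h by (simp add: mult.commute)
    qed
    then have "(\<lambda>n. \<Sum>x\<in>Om - A. \<nu> x * (\<Sum>y\<in>A. 2 ^ n * P (h / 2 ^ n) x y))
        \<longlonglongrightarrow> (\<Sum>x\<in>Om - A. \<nu> x * (\<Sum>y\<in>A. R x y * h))"
      by (intro tendsto_sum tendsto_mult_left) auto
    then show ?thesis by (simp add: sum_distrib_left algebra_simps)
  qed
  have "prob ({\<omega> \<in> space M. X t \<omega> \<notin> A} - avoids t h) \<le> (\<Sum>x\<in>Om - A. \<nu> x * (\<Sum>y\<in>A. R x y * h))"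
    using LIMSEQ_le[OF 1 2] prob_enter_grid_le[OF assms] by blast
  also have "\<dots> = (\<Sum>x\<in>Om - A. \<nu> x * (\<Sum>y\<in>A. R x y)) * h"
    by (simp add: sum_distrib_left sum_distrib_right mult.assoc)
  also have "\<dots> \<le> r * h" using flux_le_r assms by (intro mult_right_mono) auto
  finally show ?thesis .
qed

end

section \<open>Exponential limits of almost multiplicative functions\<close>

text \<open>Layer-cake formula, by Tonelli. Nonnegativity is asked only almost everywhere because on
  paths that never hit \<open>A\<close> the hitting time is the unspecified real
  \<open>Inf {}\<close>.\<close>

lemma (in prob_space) nn_integral_eq_tail:
  assumes [measurable]: "Y \<in> borel_measurable M" and nn: "AE \<omega> in M. Y \<omega> \<ge> 0"
  shows "(\<integral>\<^sup>+\<omega>. ennreal (Y \<omega>) \<partial>M)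
    = (\<integral>\<^sup>+t. ennreal (indicator {0..} t * prob {\<omega> \<in> space M. t < Y \<omega>}) \<partial>lborel)"
proof -
  interpret pair_sigma_finite M lborel by standard
  let ?f = "\<lambda>\<omega> t. if 0 \<le> t \<and> t < Y \<omega> then 1 else 0 :: ennreal"
  have "(\<integral>\<^sup>+\<omega>. ennreal (Y \<omega>) \<partial>M) = (\<integral>\<^sup>+\<omega>. (\<integral>\<^sup>+t. ?f \<omega> t \<partial>lborel) \<partial>M)"
  proof (rule nn_integral_cong_AE, use nn in eventually_elim)
    fix \<omega> assume "Y \<omega> \<ge> 0"
    have "(\<integral>\<^sup>+t. ?f \<omega> t \<partial>lborel) = (\<integral>\<^sup>+t. indicator {0..<Y \<omega>} t \<partial>lborel)"
      by (intro nn_integral_cong) (auto simp: indicator_def)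
    also have "\<dots> = ennreal (Y \<omega>)" using \<open>Y \<omega> \<ge> 0\<close> by simp
    finally show "ennreal (Y \<omega>) = (\<integral>\<^sup>+t. ?f \<omega> t \<partial>lborel)" by simp
  qed
  also have "\<dots> = (\<integral>\<^sup>+t. (\<integral>\<^sup>+\<omega>. ?f \<omega> t \<partial>M) \<partial>lborel)"
    by (rule Fubini'[symmetric]) measurable
  also have "\<dots> = (\<integral>\<^sup>+t. ennreal (indicator {0..} t * prob {\<omega> \<in> space M. t < Y \<omega>}) \<partial>lborel)"
  proof (rule nn_integral_cong)
    fix t :: real
    have "(\<integral>\<^sup>+\<omega>. ?f \<omega> t \<partial>M) = (\<integral>\<^sup>+\<omega>. indicator {0..} t * indicator {\<omega> \<in> space M. t < Y \<omega>} \<omega> \<partial>M)"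
      by (intro nn_integral_cong) (auto simp: indicator_def)
    also have "\<dots> = indicator {0..} t * emeasure M {\<omega> \<in> space M. t < Y \<omega>}"
      by (simp add: nn_integral_cmult)
    also have "\<dots> = ennreal (indicator {0..} t * prob {\<omega> \<in> space M. t < Y \<omega>})"
      by (simp add: emeasure_eq_measure ennreal_mult ennreal_indicator)
    finally show "(\<integral>\<^sup>+\<omega>. ?f \<omega> t \<partial>M) = ennreal (indicator {0..} t * prob {\<omega> \<in> space M. t < Y \<omega>})" .
  qed
  finally show ?thesis .
qed

lemma integrable_exponential_density:
  assumes "c > 0"
  shows "integrable lborel (exponential_density c)"
proof -
  interpret prob_space "density lborel (exponential_density c)"
    using assms by (rule prob_space_exponential_density)
  have "(\<integral>\<^sup>+x. ennreal (exponential_density c x) \<partial>lborel) = emeasure (density lborel (exponential_density c)) UNIV"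
    by (simp add: emeasure_density)
  then have "(\<integral>\<^sup>+x. ennreal (exponential_density c x) \<partial>lborel) = ennreal 1"
    using emeasure_space_1 by simp
  then show ?thesis
    using assms by (intro integrableI_nn_integral_finite[where x=1]) (auto simp: exponential_density_def)
qed

lemma integral_exponential_density_1: "(LINT x|lborel. exponential_density 1 x) = 1"
proof -
  interpret prob_space "density lborel (exponential_density 1)"
    by (rule prob_space_exponential_density) simp
  have "(\<integral>\<^sup>+x. ennreal (exponential_density 1 x) \<partial>lborel) = emeasure (density lborel (exponential_density 1)) UNIV"
    by (simp add: emeasure_density)
  then have "(\<integral>\<^sup>+x. ennreal (exponential_density 1 x) \<partial>lborel) = 1"
    using emeasure_space_1 by simp
  then show ?thesis
    by (subst integral_eq_nn_integral) (auto simp: exponential_density_def)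
qed

text \<open>The step inequality is iterated along multiples of \<open>L\<close>; rounding
  \<open>t\<close> down to such a multiple costs one factor \<open>1 / q\<close>.\<close>

lemma geometric_decay:
  fixes f :: "real \<Rightarrow> real"
  assumes anti: "\<And>s t. 0 \<le> s \<Longrightarrow> s \<le> t \<Longrightarrow> f t \<le> f s" and f0: "f 0 \<le> 1"
    and q: "0 < q" "q < 1" and L: "L > 0" and step: "\<And>t. t \<ge> 0 \<Longrightarrow> f (t + L) \<le> q * f t" and t: "t \<ge> 0"
  shows "f t \<le> 1 / q * exp (- (t * (- ln q / L)))"
proof -
  have it: "f (real n * L) \<le> q ^ n" for n
  proof (induction n)
    case (Suc n)
    have "f (real n * L + L) \<le> q * f (real n * L)" using L by (intro step) auto
    also have "\<dots> \<le> q * q ^ n" using Suc q by (intro mult_left_mono) auto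
    finally show ?case by (simp add: algebra_simps)
  qed (use f0 in simp)
  define n where "n = nat \<lfloor>t / L\<rfloor>"
  have n: "real n = of_int \<lfloor>t / L\<rfloor>" unfolding n_def using t L by simp
  have n1: "real n \<le> t / L" "t / L < real n + 1" unfolding n by linarith+
  have "f t \<le> f (real n * L)" using n1 L by (intro anti) (auto simp: field_simps)
  also have "\<dots> \<le> q ^ n" by (rule it)
  also have "\<dots> = exp (real n * ln q)" using q by (simp add: exp_of_nat_mult)
  also have "\<dots> \<le> exp ((t / L - 1) * ln q)"
    using n1 q by (auto intro!: mult_right_mono_neg)
  also have "\<dots> = 1 / q * exp (- (t * (- ln q / L)))"
  proof -
    have "(t / L - 1) * ln q = - (t * (- ln q / L)) - ln q" by (simp add: algebra_simps)
    then show ?thesis using q by (simp add: exp_diff)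
  qed
  finally show ?thesis .
qed

text \<open>Exponents start at 1: exponent 0 would assert that \<open>g N 0\<close> tends to 1,
  which fails for \<open>g = 0\<close>.\<close>

lemma almost_multiplicative_power:
  fixes g :: "nat \<Rightarrow> real \<Rightarrow> real"
  assumes bnd: "\<And>N u. u \<ge> 0 \<Longrightarrow> 0 \<le> g N u \<and> g N u \<le> 1"
    and mult: "\<And>u v. u \<ge> 0 \<Longrightarrow> v \<ge> 0 \<Longrightarrow> (\<lambda>N. g N (u + v) - g N u * g N v) \<longlonglongrightarrow> 0"
    and u: "u \<ge> 0"
  shows "(\<lambda>N. g N (real (Suc m) * u) - g N u ^ Suc m) \<longlonglongrightarrow> 0"
proof (induction m)
  case (Suc m)
  have "(\<lambda>N. g N u * (g N (real (Suc m) * u) - g N u ^ Suc m)) \<longlonglongrightarrow> 0"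
  proof (rule Lim_null_comparison[OF always_eventually])
    show "\<forall>N. norm (g N u * (g N (real (Suc m) * u) - g N u ^ Suc m)) \<le> \<bar>g N (real (Suc m) * u) - g N u ^ Suc m\<bar>"
      using bnd[OF u] by (auto simp: abs_mult intro!: mult_left_le_one_le)
    show "(\<lambda>N. \<bar>g N (real (Suc m) * u) - g N u ^ Suc m\<bar>) \<longlonglongrightarrow> 0"
      using Suc tendsto_rabs_zero by blast
  qed
  moreover have "(\<lambda>N. g N (real (Suc m) * u + u) - g N (real (Suc m) * u) * g N u) \<longlonglongrightarrow> 0"
    using u by (intro mult) auto
  ultimately have "(\<lambda>N. (g N (real (Suc m) * u + u) - g N (real (Suc m) * u) * g N u)
      + g N u * (g N (real (Suc m) * u) - g N u ^ Suc m)) \<longlonglongrightarrow> 0 + 0"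
    by (intro tendsto_add)
  then show ?case by (simp add: algebra_simps)
qed simp

text \<open>Approximate multiplicativity determines the limit on the rationals from its value at 1;
  monotonicity then gives all other arguments.\<close>

lemma almost_multiplicative_lim_exp:
  fixes g :: "nat \<Rightarrow> real \<Rightarrow> real"
  assumes bnd: "\<And>N u. u \<ge> 0 \<Longrightarrow> 0 \<le> g N u \<and> g N u \<le> 1"
    and anti: "\<And>N u v. 0 \<le> u \<Longrightarrow> u \<le> v \<Longrightarrow> g N v \<le> g N u"
    and mult: "\<And>u v. u \<ge> 0 \<Longrightarrow> v \<ge> 0 \<Longrightarrow> (\<lambda>N. g N (u + v) - g N u * g N v) \<longlonglongrightarrow> 0"
    and one: "(\<lambda>N. g N 1) \<longlonglongrightarrow> exp (- 1)"
    and u: "u \<ge> 0"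
  shows "(\<lambda>N. g N u) \<longlonglongrightarrow> exp (- u)"
proof -
  have inv: "(\<lambda>N. g N (1 / real (Suc k))) \<longlonglongrightarrow> exp (- 1 / real (Suc k))" for k
  proof -
    have "(\<lambda>N. g N (real (Suc k) * (1 / real (Suc k))) - g N (1 / real (Suc k)) ^ Suc k) \<longlonglongrightarrow> 0"
      by (intro almost_multiplicative_power bnd mult) auto
    then have "(\<lambda>N. g N 1 - (g N 1 - g N (1 / real (Suc k)) ^ Suc k)) \<longlonglongrightarrow> exp (- 1) - 0"
      by (intro tendsto_diff one) simp
    then have "(\<lambda>N. g N (1 / real (Suc k)) ^ Suc k) \<longlonglongrightarrow> exp (- 1)" by simp
    then have "(\<lambda>N. root (Suc k) (g N (1 / real (Suc k)) ^ Suc k)) \<longlonglongrightarrow> root (Suc k) (exp (- 1))"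
      by (rule tendsto_real_root)
    moreover have "root (Suc k) (g N (1 / real (Suc k)) ^ Suc k) = g N (1 / real (Suc k))" for N
      using bnd[of "1 / real (Suc k)" N] by (intro real_root_power_cancel) auto
    moreover have "root (Suc k) (exp (- 1)) = exp (- 1 / real (Suc k))"
    proof -
      have "(exp (- 1 / real (Suc k))) ^ Suc k = exp (real (Suc k) * (- 1 / real (Suc k)))"
        by (rule exp_of_nat_mult[symmetric])
      also have "real (Suc k) * (- 1 / real (Suc k)) = - 1" by (simp del: of_nat_Suc)
      finally have "exp (- 1 / real (Suc k)) ^ Suc k = (exp (- 1) :: real)" .
      then show ?thesis by (metis exp_ge_zero real_root_power_cancel zero_less_Suc)
    qed
    ultimately show ?thesis by simp
  qed
  \<comment> \<open>With arguments 1 and 0, multiplicativity gives \<open>g N 1 * g N 0\<close> the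
    same limit as \<open>g N 1\<close>; that limit is nonzero and can be divided out.\<close>
  have zero: "(\<lambda>N. g N 0) \<longlonglongrightarrow> exp (- 0)"
  proof -
    have "(\<lambda>N. g N 1 - (g N (1 + 0) - g N 1 * g N 0)) \<longlonglongrightarrow> exp (- 1) - 0"
      by (intro tendsto_diff one mult) auto
    then have "(\<lambda>N. g N 1 * g N 0) \<longlonglongrightarrow> exp (- 1)" by simp
    then have "(\<lambda>N. (g N 1 * g N 0) / g N 1) \<longlonglongrightarrow> exp (- 1) / exp (- 1)"
      using one by (intro tendsto_divide) auto
    moreover have "eventually (\<lambda>N. g N 1 > 0) sequentially"
      using one by (rule order_tendstoD) simp
    then have "eventually (\<lambda>N. (g N 1 * g N 0) / g N 1 = g N 0) sequentially"
      by eventually_elim simp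
    ultimately show ?thesis using Lim_transform_eventually by fastforce
  qed
  have rat: "(\<lambda>N. g N (real m / real (Suc k))) \<longlonglongrightarrow> exp (- (real m / real (Suc k)))" for m k
  proof (cases m)
    case 0
    then show ?thesis using zero by simp
  next
    case (Suc j)
    have "(\<lambda>N. g N (real (Suc j) * (1 / real (Suc k))) - g N (1 / real (Suc k)) ^ Suc j) \<longlonglongrightarrow> 0"
      by (intro almost_multiplicative_power bnd mult) auto
    then have "(\<lambda>N. (g N (real (Suc j) * (1 / real (Suc k))) - g N (1 / real (Suc k)) ^ Suc j)
        + g N (1 / real (Suc k)) ^ Suc j) \<longlonglongrightarrow> 0 + exp (- 1 / real (Suc k)) ^ Suc j"
      by (intro tendsto_add tendsto_power inv)
    then have "(\<lambda>N. g N (real (Suc j) * (1 / real (Suc k)))) \<longlonglongrightarrow> exp (- 1 / real (Suc k)) ^ Suc j" by simp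
    moreover have "exp (- 1 / real (Suc k)) ^ Suc j = exp (real (Suc j) * (- 1 / real (Suc k)))"
      by (rule exp_of_nat_mult[symmetric])
    ultimately show ?thesis using Suc by (simp del: of_nat_Suc)
  qed
  have lip: "exp (- a) - exp (- b) \<le> b - a" if "0 \<le> a" "a \<le> b" for a b :: real
  proof -
    have "exp (- a) - exp (- b) = exp (- a) * (1 - exp (- (b - a)))"
      by (simp add: algebra_simps flip: exp_add)
    also have "\<dots> \<le> 1 * (1 - exp (- (b - a)))" using that by (intro mult_right_mono) auto
    also have "\<dots> \<le> b - a"
      using exp_ge_add_one_self[of "- (b - a)"] unfolding mult_1_left by argo
    finally show ?thesis .
  qed
  show ?thesis
  proof (rule tendstoI)
    fix e :: real assume e: "e > 0"
    \<comment> \<open>Half of \<open>e\<close> pays for the distance between the neighbouring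
      fractions \<open>a\<close> and \<open>b\<close> around \<open>u\<close>, the other half for
      the convergence at these two fractions.\<close>
    obtain k where k: "1 / real (Suc k) < e / 2" using nat_approx_posE[of "e / 2"] e by auto
    define m where "m = nat \<lfloor>u * real (Suc k)\<rfloor>"
    have m: "real m = of_int \<lfloor>u * real (Suc k)\<rfloor>" unfolding m_def using u by simp
    have m1: "real m \<le> u * real (Suc k)" "u * real (Suc k) < real (Suc m)" using m by linarith+
    define a where "a = real m / real (Suc k)"
    define b where "b = real (Suc m) / real (Suc k)"
    have a: "0 \<le> a" "a \<le> u" and b: "u \<le> b"
      using m1 unfolding a_def b_def by (auto simp: pos_divide_le_eq pos_le_divide_eq simp del: of_nat_Suc)
    have ba: "b - a = 1 / real (Suc k)" unfolding a_def b_def by (simp add: add_divide_distrib)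
    have "eventually (\<lambda>N. dist (g N a) (exp (- a)) < e / 2) sequentially"
      using rat[of m k] e unfolding a_def by (intro tendstoD) auto
    moreover have "eventually (\<lambda>N. dist (g N b) (exp (- b)) < e / 2) sequentially"
      using rat[of "Suc m" k] e unfolding b_def by (intro tendstoD) auto
    ultimately show "eventually (\<lambda>N. dist (g N u) (exp (- u)) < e) sequentially"
    proof eventually_elim
      case (elim N)
      have "g N u \<le> g N a" "g N b \<le> g N u" using a b u by (auto intro!: anti)
      moreover have "exp (- a) - exp (- u) \<le> u - a" "exp (- u) - exp (- b) \<le> b - u"
        using a b u by (auto intro!: lip)
      ultimately show ?case using elim ba k a b unfolding dist_real_def by linarith
    qed
  qed
qed

text \<open>Monotonicity replaces uniform convergence: \<open>c N * x\<close> is compared with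
  \<open>y * x\<close> for a fixed \<open>y\<close> slightly above 1 (lower bound) or below 1 (upper
  bound), where pointwise convergence suffices.\<close>

lemma antimono_lim_exp_scaled:
  fixes g :: "nat \<Rightarrow> real \<Rightarrow> real"
  assumes anti: "\<And>N u v. 0 \<le> u \<Longrightarrow> u \<le> v \<Longrightarrow> g N v \<le> g N u"
    and lim: "\<And>u. u \<ge> 0 \<Longrightarrow> (\<lambda>N. g N u) \<longlonglongrightarrow> exp (- u)"
    and c: "c \<longlonglongrightarrow> 1" and x: "x \<ge> 0"
  shows "(\<lambda>N. g N (c N * x)) \<longlonglongrightarrow> exp (- x)"
proof (rule order_tendstoI)
  have cont: "((\<lambda>y. exp (- (y * x))) \<longlongrightarrow> exp (- (1 * x))) (at 1 within S)" for S :: "real set"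
    by (intro tendsto_intros)
  have cpos: "eventually (\<lambda>N. c N > 0) sequentially" using c by (rule order_tendstoD) simp
  fix a assume "a < exp (- x)"
  then have "eventually (\<lambda>y. a < exp (- (y * x))) (at_right 1)"
    using cont[of "{1<..}"] by (intro order_tendstoD) auto
  moreover have "eventually (\<lambda>y::real. y > 1) (at_right 1)" by (simp add: eventually_at_right_less)
  ultimately have "eventually (\<lambda>y. a < exp (- (y * x)) \<and> y > 1) (at_right 1)" by eventually_elim simp
  then obtain y where y: "a < exp (- (y * x))" "y > 1"
    using eventually_happens'[OF trivial_limit_at_right_real] by blast
  have "eventually (\<lambda>N. a < g N (y * x)) sequentially"
    using lim[of "y * x"] x y by (intro order_tendstoD) auto
  moreover have "eventually (\<lambda>N. c N < y) sequentially" using c y by (intro order_tendstoD) auto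
  ultimately show "eventually (\<lambda>N. a < g N (c N * x)) sequentially"
    using cpos
  proof eventually_elim
    case (elim N)
    have "g N (y * x) \<le> g N (c N * x)" using elim x by (intro anti) (auto intro: mult_right_mono)
    then show ?case using elim by simp
  qed
next
  have cont: "((\<lambda>y. exp (- (y * x))) \<longlongrightarrow> exp (- (1 * x))) (at 1 within S)" for S :: "real set"
    by (intro tendsto_intros)
  fix a assume "exp (- x) < a"
  then have "eventually (\<lambda>y. exp (- (y * x)) < a) (at_left 1)"
    using cont[of "{..<1}"] by (intro order_tendstoD) auto
  moreover have "eventually (\<lambda>y::real. y \<in> {0<..<1}) (at_left 1)" by (rule eventually_at_left_real) simp
  ultimately have "eventually (\<lambda>y. exp (- (y * x)) < a \<and> y \<in> {0<..<1}) (at_left 1)" by eventually_elim simp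
  then obtain y where y: "exp (- (y * x)) < a" "y \<in> {0<..<1}"
    using eventually_happens'[OF trivial_limit_at_left_real] by blast
  have "eventually (\<lambda>N. g N (y * x) < a) sequentially"
    using lim[of "y * x"] x y by (intro order_tendstoD) auto
  moreover have "eventually (\<lambda>N. y < c N) sequentially" using c y by (intro order_tendstoD) auto
  ultimately show "eventually (\<lambda>N. g N (c N * x) < a) sequentially"
  proof eventually_elim
    case (elim N)
    have "g N (c N * x) \<le> g N (y * x)" using elim x y by (intro anti) (auto intro: mult_right_mono)
    then show ?case using elim by simp
  qed
qed

lemma lipschitz_decreasing_continuous_on:
  fixes f :: "real \<Rightarrow> real"
  assumes anti: "\<And>s t. 0 \<le> s \<Longrightarrow> s \<le> t \<Longrightarrow> f t \<le> f s"
    and r: "r > 0" and lip: "\<And>t h. t \<ge> 0 \<Longrightarrow> h \<ge> 0 \<Longrightarrow> f t - f (t + h) \<le> r * h"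
  shows "continuous_on {0..} f"
proof (rule continuous_onI)
  have main: "\<bar>f t - f s\<bar> \<le> r * \<bar>t - s\<bar>" if "0 \<le> s" "s \<le> t" for s t
    using anti[OF that] lip[of s "t - s"] that by simp
  fix x e :: real assume "x \<in> {0..}" "e > 0"
  then show "\<exists>d>0. \<forall>x'\<in>{0..}. dist x' x < d \<longrightarrow> dist (f x') (f x) \<le> e"
  proof (intro exI[of _ "e / r"] conjI ballI impI)
    fix y assume y: "y \<in> {0..}" "dist y x < e / r"
    have "\<bar>f y - f x\<bar> \<le> r * \<bar>y - x\<bar>"
      using main[of x y] main[of y x] y \<open>x \<in> {0..}\<close> by (cases "x \<le> y") (auto simp: abs_minus_commute)
    also have "\<dots> \<le> e" using y r by (simp add: dist_real_def field_simps)
    finally show "dist (f y) (f x) \<le> e" by (simp add: dist_real_def)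
  qed (use r in simp)
qed

lemma integrable_geometric_decay:
  fixes f :: "real \<Rightarrow> real"
  assumes anti: "\<And>s t. 0 \<le> s \<Longrightarrow> s \<le> t \<Longrightarrow> f t \<le> f s" and f0: "f 0 \<le> 1"
    and nn: "\<And>t. t \<ge> 0 \<Longrightarrow> f t \<ge> 0" and cont: "continuous_on {0..} f"
    and q: "0 < q" "q < 1" and L: "L > 0" and step: "\<And>t. t \<ge> 0 \<Longrightarrow> f (t + L) \<le> q * f t"
  shows "integrable lborel (\<lambda>t. indicator {0..} t * f t)"
proof (rule Bochner_Integration.integrable_bound)
  define c where "c = - ln q / L"
  have c: "c > 0" using q L by (simp add: c_def ln_less_zero divide_neg_pos)
  show "integrable lborel (\<lambda>t. 1 / (q * c) * exponential_density c t)"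
    using integrable_exponential_density[OF c] by simp
  show "(\<lambda>t. indicator {0..} t * f t) \<in> borel_measurable lborel"
    using borel_measurable_continuous_on_indicator[OF _ cont] by simp
  show "AE t in lborel. norm (indicator {0..} t * f t) \<le> norm (1 / (q * c) * exponential_density c t)"
  proof (rule AE_I2)
    fix t :: real
    show "norm (indicator {0..} t * f t) \<le> norm (1 / (q * c) * exponential_density c t)"
    proof (cases "t \<ge> 0")
      case True
      have "f t \<le> 1 / q * exp (- (t * c))"
        unfolding c_def by (rule geometric_decay) (use assms True in auto)
      then show ?thesis using True nn[OF True] c q by (simp add: exponential_density_def abs_mult)
    qed simp
  qed
qed

text \<open>The analysis detached from the chain: \<open>f N\<close> plays the survival function,
  \<open>E N\<close> its mean. \<open>S\<close> and \<open>D\<close> may vary with \<open>N\<close>,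
  as the mixing time does. The first conclusion makes the division by the mean legitimate for large
  \<open>N\<close>.\<close>

lemma quasi_exponential_limit:
  fixes f :: "nat \<Rightarrow> real \<Rightarrow> real" and r :: "nat \<Rightarrow> real"
  assumes anti: "\<And>N s t. 0 \<le> s \<Longrightarrow> s \<le> t \<Longrightarrow> f N t \<le> f N s"
    and bnd: "\<And>N t. t \<ge> 0 \<Longrightarrow> 0 \<le> f N t \<and> f N t \<le> 1"
    and r: "\<And>N. r N > 0"
    and lip: "\<And>N t h. t \<ge> 0 \<Longrightarrow> h \<ge> 0 \<Longrightarrow> f N t - f N (t + h) \<le> r N * h"
    and vanish: "\<And>N. (f N \<longlongrightarrow> 0) at_top"
    and start: "(\<lambda>N. f N 0) \<longlonglongrightarrow> 1"
    and quasi: "\<And>e. e > 0 \<Longrightarrow> eventually (\<lambda>N. \<exists>S D. S \<ge> 0 \<and> D \<le> e \<and> r N * S \<le> e \<and>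
        (\<forall>t s. t \<ge> 0 \<longrightarrow> s \<ge> 0 \<longrightarrow> \<bar>f N (t + s) - f N t * f N s\<bar> \<le> e \<and>
           f N (t + S + s) \<le> f N t * (f N s + D))) sequentially"
  defines "E \<equiv> \<lambda>N. LINT t|lborel. indicator {0..} t * f N t"
  shows "eventually (\<lambda>N. E N > 0) sequentially" and "x \<ge> 0 \<Longrightarrow> (\<lambda>N. f N (E N * x)) \<longlonglongrightarrow> exp (- x)"
proof -
  have e1: "exp (- 1) \<le> (1 / 2 :: real)"
    using exp_ge_add_one_self[of "1::real"] by (simp add: exp_minus field_simps)
  have cont: "continuous_on {0..} (f N)" for N
    using anti r lip by (intro lipschitz_decreasing_continuous_on[where r = "r N"]) auto
  \<comment> \<open>In units of \<open>\<theta>\<close> the period 2 consists of one unit covering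
    the gap \<open>S\<close> and one window of length \<open>\<theta>\<close>. The factor 3/4 is
    1/2, a bound for \<open>exp (- 1)\<close>, plus 1/4, the bound for \<open>D\<close>.\<close>
  define good where "good N \<theta> \<longleftrightarrow> \<theta> > 0 \<and> f N \<theta> = exp (- 1) \<and>
     (\<forall>u\<ge>0. f N (\<theta> * (u + 2)) \<le> 3 / 4 * f N (\<theta> * u))" for N \<theta>
  have "eventually (\<lambda>N. \<exists>\<theta>. good N \<theta>) sequentially"
  proof -
    have "eventually (\<lambda>N. f N 0 > 3 / 4) sequentially" using start by (rule order_tendstoD) simp
    moreover have "0 < (1 / 4 :: real)" by simp
    note quasi[OF this]
    ultimately show ?thesis
    proof eventually_elim
      case (elim N)
      obtain S D where S: "S \<ge> 0" "D \<le> 1 / 4" "r N * S \<le> 1 / 4"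
        "\<And>t s. t \<ge> 0 \<Longrightarrow> s \<ge> 0 \<Longrightarrow> f N (t + S + s) \<le> f N t * (f N s + D)"
        using elim by blast
      have "eventually (\<lambda>t. f N t < exp (- 1)) at_top" using vanish by (rule order_tendstoD) simp
      then have "eventually (\<lambda>t. f N t < exp (- 1) \<and> t \<ge> 0) at_top"
        using eventually_ge_at_top[of 0] by eventually_elim simp
      then obtain b where b: "f N b < exp (- 1)" "b \<ge> 0"
        using eventually_happens'[OF trivial_limit_at_top_linorder] by blast
      have "\<exists>\<theta>\<ge>0. \<theta> \<le> b \<and> f N \<theta> = exp (- 1)"
        using b elim(1) e1 by (intro IVT2' continuous_on_subset[OF cont]) auto
      then obtain \<theta> where \<theta>: "\<theta> \<ge> 0" "f N \<theta> = exp (- 1)" by blast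
      \<comment> \<open>By time \<open>\<theta>\<close> the function has dropped from above 3/4 to
        at most 1/2. The Lipschitz bound then makes \<open>r N * \<theta>\<close> at least 1/4,
        hence at least \<open>r N * S\<close>, so the gap is no longer than
        \<open>\<theta>\<close>.\<close>
      have "1 / 4 \<le> r N * \<theta>" using lip[of 0 \<theta> N] \<theta> elim(1) e1 by simp
      moreover from this have "\<theta> \<noteq> 0" by auto
      moreover have "r N * S \<le> r N * \<theta>" using calculation(1) S(3) by linarith
      ultimately have S\<theta>: "S \<le> \<theta>" "\<theta> > 0"
        using r[of N] \<theta>(1) by simp_all
      have "f N (\<theta> * (u + 2)) \<le> 3 / 4 * f N (\<theta> * u)" if "u \<ge> 0" for u
      proof -
        have "f N (\<theta> * (u + 2)) \<le> f N (\<theta> * u + S + \<theta>)"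
          using that \<theta> S S\<theta> by (intro anti) (auto simp: algebra_simps)
        also have "\<dots> \<le> f N (\<theta> * u) * (f N \<theta> + D)" using that \<theta> by (intro S) auto
        also have "\<dots> \<le> f N (\<theta> * u) * (3 / 4)"
          using \<theta>(2) S(2) e1 bnd[of "\<theta> * u" N] that \<theta>(1) by (intro mult_left_mono) auto
        finally show ?thesis by simp
      qed
      then show "\<exists>\<theta>. good N \<theta>" unfolding good_def using \<theta> S\<theta> by blast
    qed
  qed
  moreover define \<theta> where "\<theta> N = (SOME \<theta>. good N \<theta>)" for N
  ultimately have \<theta>: "eventually (\<lambda>N. good N (\<theta> N)) sequentially"
    by (auto elim: eventually_mono intro: someI)
  \<comment> \<open>For the \<open>N\<close> without a good \<open>\<theta>\<close> the limit itself
    is a placeholder, so that bounds and monotonicity hold for every \<open>N\<close>.\<close>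
  define g where "g N u = (if good N (\<theta> N) then f N (\<theta> N * u) else exp (- u))" for N u
  have \<theta>pos: "\<theta> N > 0" if "good N (\<theta> N)" for N using that by (simp add: good_def)
  have g_anti: "g N v \<le> g N u" if "0 \<le> u" "u \<le> v" for N u v
    using that \<theta>pos[of N] by (auto simp: g_def intro!: anti mult_left_mono)
  have g_bnd: "0 \<le> g N u \<and> g N u \<le> 1" if "0 \<le> u" for N u
    using that \<theta>pos[of N] bnd[of "\<theta> N * u" N] by (auto simp: g_def)
  have g_eq: "eventually (\<lambda>N. \<forall>u. g N u = f N (\<theta> N * u)) sequentially"
    using \<theta> by eventually_elim (simp add: g_def)
  have g_lim: "(\<lambda>N. g N u) \<longlonglongrightarrow> exp (- u)" if "u \<ge> 0" for u
  proof (rule almost_multiplicative_lim_exp[OF g_bnd g_anti _ _ that])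
    have "eventually (\<lambda>N. g N 1 = exp (- 1)) sequentially"
      using \<theta> by eventually_elim (simp add: g_def good_def)
    then show "(\<lambda>N. g N 1) \<longlonglongrightarrow> exp (- 1)" by (rule tendsto_eventually)
    fix u v :: real assume uv: "u \<ge> 0" "v \<ge> 0"
    show "(\<lambda>N. g N (u + v) - g N u * g N v) \<longlonglongrightarrow> 0"
    proof (rule tendstoI)
      fix e :: real assume "e > 0"
      then have "eventually (\<lambda>N. \<exists>S D. S \<ge> 0 \<and> D \<le> e / 2 \<and> r N * S \<le> e / 2 \<and>
        (\<forall>t s. t \<ge> 0 \<longrightarrow> s \<ge> 0 \<longrightarrow> \<bar>f N (t + s) - f N t * f N s\<bar> \<le> e / 2 \<and>
           f N (t + S + s) \<le> f N t * (f N s + D))) sequentially"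
        by (intro quasi) simp
      then show "eventually (\<lambda>N. dist (g N (u + v) - g N u * g N v) 0 < e) sequentially"
        using \<theta>
      proof eventually_elim
        case (elim N)
        have "\<theta> N * u \<ge> 0" "\<theta> N * v \<ge> 0" using uv \<theta>pos[OF elim(2)] by auto
        then have "\<bar>f N (\<theta> N * u + \<theta> N * v) - f N (\<theta> N * u) * f N (\<theta> N * v)\<bar> \<le> e / 2"
          using elim(1) by blast
        then show ?case using elim(2) \<open>e > 0\<close> by (simp add: g_def distrib_left dist_real_def)
      qed
    qed
  qed
  \<comment> \<open>The rate belonging to a loss of the factor 3/4 in every period of length 2. In
    the dominating function below, 4/3 is the rounding factor of \<open>geometric_decay\<close>, and
    \<open>1 / c\<close> cancels the prefactor of \<open>exponential_density c\<close>.\<close>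
  define c :: real where "c = - ln (3 / 4) / 2"
  have c: "c > 0" by (simp add: c_def ln_less_zero divide_neg_pos)
  define G where "G N u = (if good N (\<theta> N) then indicator {0..} u * g N u else 0)" for N u
  have G_bound: "norm (G N u) \<le> 4 / (3 * c) * exponential_density c u" for N u
  proof (cases "good N (\<theta> N) \<and> u \<ge> 0")
    case True
    have "g N u \<le> 1 / (3 / 4) * exp (- (u * (- ln (3 / 4) / 2)))"
    proof (rule geometric_decay)
      show "g N (t + 2) \<le> 3 / 4 * g N t" if "t \<ge> 0" for t
        using True that by (simp add: g_def good_def)
    qed (use True g_anti g_bnd in auto)
    then have "g N u \<le> 4 / 3 * exp (- (u * c))" by (simp add: c_def)
    then show ?thesis using True c g_bnd[of u N] by (simp add: G_def exponential_density_def)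
  next
    case False
    then show ?thesis using c by (auto simp: G_def exponential_density_def)
  qed
  have G_meas: "G N \<in> borel_measurable lborel" for N
  proof (cases "good N (\<theta> N)")
    case True
    have "continuous_on {0..} (\<lambda>u. f N (\<theta> N * u))"
      using \<theta>pos[OF True] by (intro continuous_on_compose2[OF cont] continuous_intros) auto
    then have "(\<lambda>u. indicator {0..} u * f N (\<theta> N * u)) \<in> borel_measurable borel"
      using borel_measurable_continuous_on_indicator[of "{0..}" "\<lambda>u. f N (\<theta> N * u)"] by simp
    moreover have "G N = (\<lambda>u. indicator {0..} u * f N (\<theta> N * u))"
      using True by (auto simp: G_def g_def)
    ultimately show ?thesis by simp
  qed (simp add: G_def[abs_def])
  have "(\<lambda>N. LINT u|lborel. G N u) \<longlonglongrightarrow> (LINT u|lborel. exponential_density 1 u)"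
  proof (rule integral_dominated_convergence)
    show "integrable lborel (\<lambda>u. 4 / (3 * c) * exponential_density c u)"
      using integrable_exponential_density[OF c] by simp
    show "AE u in lborel. (\<lambda>N. G N u) \<longlonglongrightarrow> exponential_density 1 u"
    proof (rule AE_I2)
      fix u :: real
      have ev: "eventually (\<lambda>N. indicator {0..} u * g N u = G N u) sequentially"
        using \<theta> by eventually_elim (simp add: G_def)
      have "(\<lambda>N. indicator {0..} u * g N u) \<longlonglongrightarrow> exponential_density 1 u"
        using g_lim[of u] by (cases "u \<ge> 0") (auto simp: exponential_density_def)
      then show "(\<lambda>N. G N u) \<longlonglongrightarrow> exponential_density 1 u"
        using ev by (rule Lim_transform_eventually)
    qed
  qed (use G_meas G_bound in auto)
  then have G_lim: "(\<lambda>N. LINT u|lborel. G N u) \<longlonglongrightarrow> 1"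
    by (simp add: integral_exponential_density_1)
  have E_eq: "eventually (\<lambda>N. E N = \<theta> N * (LINT u|lborel. G N u)) sequentially"
    using \<theta>
  proof eventually_elim
    case (elim N)
    \<comment> \<open>Substitution of \<open>\<theta> N * u\<close> for \<open>t\<close>; as
      \<open>\<theta> N\<close> is positive, the half-line is mapped onto itself.\<close>
    have "E N = \<bar>\<theta> N\<bar> *\<^sub>R (LINT u|lborel. indicator {0..} (0 + \<theta> N * u) * f N (0 + \<theta> N * u))"
      unfolding E_def using \<theta>pos[OF elim] by (intro lborel_integral_real_affine) simp
    also have "(\<lambda>u. indicator {0..} (0 + \<theta> N * u) * f N (0 + \<theta> N * u)) = G N"
      using elim \<theta>pos[OF elim] by (auto simp: G_def g_def indicator_def zero_le_mult_iff)
    finally show ?case using \<theta>pos[OF elim] by simp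
  qed
  show "eventually (\<lambda>N. E N > 0) sequentially"
  proof -
    have "eventually (\<lambda>N. (LINT u|lborel. G N u) > 0) sequentially"
      using G_lim by (rule order_tendstoD) simp
    then show ?thesis using E_eq \<theta> by eventually_elim (simp add: \<theta>pos)
  qed
  assume x: "x \<ge> 0"
  have "(\<lambda>N. g N ((LINT u|lborel. G N u) * x)) \<longlonglongrightarrow> exp (- x)"
    by (rule antimono_lim_exp_scaled[OF g_anti g_lim G_lim x])
  moreover have "eventually (\<lambda>N. g N ((LINT u|lborel. G N u) * x) = f N (E N * x)) sequentially"
    using g_eq E_eq by eventually_elim (simp add: mult.assoc)
  ultimately show "(\<lambda>N. f N (E N * x)) \<longlonglongrightarrow> exp (- x)"
    by (rule Lim_transform_eventually)
qed

section \<open>The hitting time\<close>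

context stationary_ctmc_hitting
begin

section \<open>Properties of the survival function\<close>

lemma survival_0: "survival 0 = 1 - (\<Sum>x\<in>A. \<nu> x)"
proof -
  have "survival 0 = prob {\<omega> \<in> space M. X 0 \<omega> \<in> Om - A \<and> X (0 + 0) \<omega> \<in> Om}"
    unfolding survival_def avoids_def using X_in by (intro arg_cong[where f = prob]) auto
  also have "\<dots> = (\<Sum>y\<in>Om. \<Sum>x\<in>Om - A. \<nu> x * P 0 x y)" by (intro prob_two_times) auto
  also have "\<dots> = (\<Sum>x\<in>Om - A. \<nu> x * (\<Sum>y\<in>Om. P 0 x y))"
    by (subst sum.swap) (simp add: sum_distrib_left)
  also have "\<dots> = (\<Sum>x\<in>Om - A. \<nu> x)" using P_sum by (intro sum.cong) auto
  also have "\<dots> = (\<Sum>x\<in>Om. \<nu> x) - (\<Sum>x\<in>A. \<nu> x)" using fin A_sub by (rule sum_diff)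
  finally show ?thesis using nu_sum by simp
qed

lemma nu_A: "0 < (\<Sum>x\<in>A. \<nu> x)"
proof (rule sum_pos)
  show "A \<noteq> {}" using r_pos by (auto simp: rate_into_def)
qed (use A_sub fin nu_pos in \<open>auto intro: finite_subset\<close>)

lemma survival_antimono: "0 \<le> s \<Longrightarrow> s \<le> t \<Longrightarrow> survival t \<le> survival s"
  unfolding survival_def by (intro finite_measure_mono avoids_sets) (auto simp: avoids_def)

lemma survival_bounds: "0 \<le> survival t" "survival t \<le> 1"
  unfolding survival_def by auto

lemma X_avoid_sets: "t \<ge> 0 \<Longrightarrow> {\<omega> \<in> space M. X t \<omega> \<notin> A} \<in> sets M"
  using X_sets[of t "- A"] by simp

text \<open>Forgetting what happened before time \<open>t\<close> enlarges the event to the one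
  estimated in \<open>prob_enter_le\<close>.\<close>

lemma survival_lipschitz:
  assumes "t \<ge> 0" "h \<ge> 0"
  shows "survival t - survival (t + h) \<le> r * h"
proof -
  have "survival t - survival (t + h) = prob (avoids 0 t - avoids 0 (t + h))"
    unfolding survival_def using assms
    by (intro finite_measure_Diff[symmetric] avoids_sets) (auto simp: avoids_def)
  also have "\<dots> \<le> prob ({\<omega> \<in> space M. X t \<omega> \<notin> A} - avoids t h)"
  proof (rule finite_measure_mono)
    show "avoids 0 t - avoids 0 (t + h) \<subseteq> {\<omega> \<in> space M. X t \<omega> \<notin> A} - avoids t h"
    proof (intro subsetI DiffI)
      fix \<omega> assume w: "\<omega> \<in> avoids 0 t - avoids 0 (t + h)"
      then show "\<omega> \<in> {\<omega> \<in> space M. X t \<omega> \<notin> A}" using assms by (auto simp: avoids_def)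
      show "\<omega> \<notin> avoids t h"
      proof
        assume "\<omega> \<in> avoids t h"
        then have "X s \<omega> \<notin> A" if "s \<in> {0..t + h}" for s
          using w that by (cases "s \<le> t") (auto simp: avoids_def)
        then show False using w by (auto simp: avoids_def)
      qed
    qed
  qed (use assms in \<open>auto intro!: sets.Diff X_avoid_sets avoids_sets\<close>)
  also have "\<dots> \<le> r * h" by (rule prob_enter_le[OF assms])
  finally show ?thesis .
qed

text \<open>Opening the gap only drops a constraint. Conversely, a path that avoids \<open>A\<close>
  in both windows but not throughout is outside \<open>A\<close> at time \<open>t\<close> and enters
  it during the gap.\<close>

lemma survival_gap:
  assumes "t \<ge> 0" "S \<ge> 0" "s \<ge> 0"
  shows "survival (t + S + s) \<le> prob (avoids 0 t \<inter> avoids (t + S) s)"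
    and "prob (avoids 0 t \<inter> avoids (t + S) s) \<le> survival (t + S + s) + r * S"
proof -
  have meas: "avoids 0 t \<inter> avoids (t + S) s \<in> sets M" "avoids 0 (t + S + s) \<in> sets M"
    using assms by (auto intro!: sets.Int avoids_sets)
  show "survival (t + S + s) \<le> prob (avoids 0 t \<inter> avoids (t + S) s)"
    unfolding survival_def
    by (intro finite_measure_mono meas) (use assms in \<open>auto simp: avoids_def\<close>)
  have "avoids 0 t \<inter> avoids (t + S) s \<subseteq> avoids 0 (t + S + s) \<union> ({\<omega> \<in> space M. X t \<omega> \<notin> A} - avoids t S)"
  proof
    fix \<omega> assume w: "\<omega> \<in> avoids 0 t \<inter> avoids (t + S) s"
    show "\<omega> \<in> avoids 0 (t + S + s) \<union> ({\<omega> \<in> space M. X t \<omega> \<notin> A} - avoids t S)"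
    proof (cases "\<omega> \<in> avoids t S")
      case True
      then have "X v \<omega> \<notin> A" if "v \<in> {0..t + S + s}" for v
        using w that by (cases "v \<le> t"; cases "v \<le> t + S") (auto simp: avoids_def)
      then show ?thesis using w by (auto simp: avoids_def)
    next
      case False
      then show ?thesis using w assms by (auto simp: avoids_def)
    qed
  qed
  then have "prob (avoids 0 t \<inter> avoids (t + S) s)
      \<le> prob (avoids 0 (t + S + s) \<union> ({\<omega> \<in> space M. X t \<omega> \<notin> A} - avoids t S))"
    using assms by (intro finite_measure_mono sets.Un sets.Diff X_avoid_sets avoids_sets) auto
  also have "\<dots> \<le> prob (avoids 0 (t + S + s)) + prob ({\<omega> \<in> space M. X t \<omega> \<notin> A} - avoids t S)"
    using assms by (intro measure_Un_le sets.Diff X_avoid_sets avoids_sets) auto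
  also have "\<dots> \<le> survival (t + S + s) + r * S"
    unfolding survival_def using prob_enter_le[of t S] assms by simp
  finally show "prob (avoids 0 t \<inter> avoids (t + S) s) \<le> survival (t + S + s) + r * S" .
qed

lemma survival_upper:
  assumes "t \<ge> 0" "s \<ge> 0" "mixed S D"
  shows "survival (t + S + s) \<le> survival t * (survival s + D)"
proof -
  have "S \<ge> 0" using assms by (simp add: mixed_def)
  then show ?thesis
    using survival_gap(1)[of t S s] prob_avoids_decouple[OF assms] assms by (simp add: distrib_left)
qed

text \<open>Each side pays \<open>r * S\<close> once besides the decoupling error: the upper side
  when the Lipschitz bound shortens \<open>t + s + S\<close> to \<open>t + s\<close>, the lower side
  when the gap is closed.\<close>

lemma survival_quasi:
  assumes "t \<ge> 0" "s \<ge> 0" "mixed S D" "D \<ge> 0"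
  shows "\<bar>survival (t + s) - survival t * survival s\<bar> \<le> D + r * S"
proof -
  have S: "S \<ge> 0" using assms by (simp add: mixed_def)
  have "survival t * D \<le> 1 * D" using survival_bounds assms by (intro mult_right_mono) auto
  moreover have "survival (t + s) - survival (t + s + S) \<le> r * S"
    using assms S by (intro survival_lipschitz) auto
  moreover have "survival (t + s + S) \<le> survival (t + s)"
    using assms S by (intro survival_antimono) auto
  ultimately show ?thesis
    using survival_gap[of t S s] prob_avoids_decouple[OF assms(1-3)] assms S
    by (simp add: ac_simps)
qed

text \<open>With a second window of length 0 the factor is \<open>survival 0 + D\<close>, which is
  below 1 once \<open>D\<close> is smaller than the positive mass of \<open>A\<close>. The constants
  depend on the chain; this yields integrability and decay for each fixed chain, while uniformity in
  \<open>N\<close> comes from \<open>quasi_exponential_limit\<close>.\<close>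

lemma survival_contracts: "\<exists>q L. 0 < q \<and> q < 1 \<and> L > 0 \<and> (\<forall>t\<ge>0. survival (t + L) \<le> q * survival t)"
proof -
  have ne: "Om \<noteq> {}" using nu_A A_sub by auto
  obtain T where T: "T > 0" "mixed T (1/2)" using exists_mixed_half[OF ne] by blast
  have "eventually (\<lambda>k. (1 / 2 :: real) ^ k < (\<Sum>x\<in>A. \<nu> x)) sequentially"
    using nu_A by (intro order_tendstoD[OF LIMSEQ_power_zero]) auto
  then obtain k where "\<And>j. j \<ge> k \<Longrightarrow> (1 / 2 :: real) ^ j < (\<Sum>x\<in>A. \<nu> x)"
    unfolding eventually_sequentially by blast
  from this[of "Suc k"] have k: "(1 / 2 :: real) ^ Suc k < (\<Sum>x\<in>A. \<nu> x)" by simp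
  define q where "q = survival 0 + (1 / 2) ^ Suc k"
  have "q > 0" unfolding q_def using survival_bounds(1) by (intro add_nonneg_pos) auto
  moreover have "q < 1" unfolding q_def survival_0 using k by simp
  moreover have "survival (t + real (Suc k) * T) \<le> q * survival t" if "t \<ge> 0" for t
    using survival_upper[OF that order_refl mixed_pow[OF T(2) ne, of k]]
    by (simp add: q_def mult.commute)
  moreover have "real (Suc k) * T > 0" using T by simp
  ultimately show ?thesis by blast
qed

lemma survival_continuous: "continuous_on {0..} survival"
  using survival_antimono r_pos survival_lipschitz
  by (rule lipschitz_decreasing_continuous_on)

lemma survival_integrable: "integrable lborel (\<lambda>t. indicator {0..} t * survival t)"
proof -
  obtain q L where "0 < q" "q < 1" "L > 0" "\<And>t. t \<ge> 0 \<Longrightarrow> survival (t + L) \<le> q * survival t"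
    using survival_contracts by blast
  then show ?thesis
    using survival_antimono survival_bounds survival_continuous
    by (intro integrable_geometric_decay[of survival q L]) auto
qed

lemma survival_tendsto_0: "(survival \<longlongrightarrow> 0) at_top"
proof -
  obtain q L where q: "0 < q" "q < 1" "L > 0" "\<And>t. t \<ge> 0 \<Longrightarrow> survival (t + L) \<le> q * survival t"
    using survival_contracts by blast
  define c where "c = - ln q / L"
  have c: "c > 0" using q by (simp add: c_def ln_less_zero divide_neg_pos)
  have "((\<lambda>t. exp (- (t * c))) \<longlongrightarrow> 0) at_top"
    using c by (auto intro!: filterlim_compose[OF exp_at_bot] filterlim_ident
      filterlim_at_top_mult_tendsto_pos simp: filterlim_uminus_at_bot)
  then have "((\<lambda>t. 1 / q * exp (- (t * c))) \<longlongrightarrow> 0) at_top" by (rule tendsto_mult_right_zero)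
  then show ?thesis
  proof (rule Lim_null_comparison[rotated])
    show "eventually (\<lambda>t. norm (survival t) \<le> 1 / q * exp (- (t * c))) at_top"
      using eventually_ge_at_top[of 0]
    proof eventually_elim
      case (elim t)
      have "survival t \<le> 1 / q * exp (- (t * c))"
        unfolding c_def by (rule geometric_decay) (use survival_antimono survival_bounds q elim in auto)
      then show ?case using survival_bounds by simp
    qed
  qed
qed

section \<open>Law and mean of the hitting time\<close>

abbreviation "H \<equiv> hitting_time X A"

definition ever_hits :: "'b set" where
  "ever_hits = {\<omega> \<in> space M. \<exists>t>0. X t \<omega> \<in> A}"

text \<open>Links visits at closed endpoints, time 0 included, with the infimum over strictly
  positive times.\<close>

lemma hits_immediately:
  assumes "\<omega> \<in> space M" "t \<ge> 0" "X t \<omega> \<in> A" "e > 0"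
  shows "\<exists>s>t. s < t + e \<and> X s \<omega> \<in> A"
proof -
  obtain d where d: "d > 0" "\<And>s. t \<le> s \<Longrightarrow> s < t + d \<Longrightarrow> X s \<omega> = X t \<omega>"
    using X_right_cont[OF assms(1,2)] by blast
  define s where "s = t + min d e / 2"
  have s: "t < s" "s < t + d" "s < t + e" using d(1) assms(4) by (auto simp: s_def)
  then have "X s \<omega> = X t \<omega>" using d(2)[of s] by simp
  then show ?thesis using s assms(3) by metis
qed

lemma never_hits_eq: "space M - ever_hits = (\<Inter>n. avoids 0 (real n))"
proof (intro equalityI subsetI)
  fix \<omega> assume w: "\<omega> \<in> space M - ever_hits"
  have "X s \<omega> \<notin> A" if "s \<ge> 0" for s
  proof
    assume "X s \<omega> \<in> A"
    then obtain v where "v > s" "X v \<omega> \<in> A" using hits_immediately[of \<omega> s 1] w \<open>s \<ge> 0\<close> by auto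
    then show False using w that by (auto simp: ever_hits_def)
  qed
  then show "\<omega> \<in> (\<Inter>n. avoids 0 (real n))" using w by (auto simp: avoids_def)
next
  fix \<omega> assume w: "\<omega> \<in> (\<Inter>n. avoids 0 (real n))"
  have "X t \<omega> \<notin> A" if "t > 0" for t
  proof -
    obtain n where "t \<le> real n" using real_arch_simple by blast
    moreover have "\<omega> \<in> avoids 0 (real n)" using w by blast
    ultimately show ?thesis using that by (auto simp: avoids_def)
  qed
  then show "\<omega> \<in> space M - ever_hits" using w by (auto simp: ever_hits_def avoids_def)
qed

lemma ever_hits_sets: "ever_hits \<in> sets M"
proof -
  have "(\<Inter>n. avoids 0 (real n)) \<in> sets M"
    by (intro sets.countable_INT) (auto simp: avoids_sets)
  then have "space M - (space M - ever_hits) \<in> sets M" unfolding never_hits_eq by (rule sets.compl_sets)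
  moreover have "space M - (space M - ever_hits) = ever_hits" by (auto simp: ever_hits_def)
  ultimately show ?thesis by simp
qed

lemma prob_never_hits: "prob (space M - ever_hits) = 0"
proof -
  have "(\<lambda>n. prob (avoids 0 (real n))) \<longlonglongrightarrow> prob (\<Inter>n. avoids 0 (real n))"
  proof (rule finite_Lim_measure_decseq)
    show "range (\<lambda>n. avoids 0 (real n)) \<subseteq> sets M" using avoids_sets by auto
    show "decseq (\<lambda>n. avoids 0 (real n))" by (auto simp: decseq_def avoids_def)
  qed
  moreover have "(\<lambda>n. prob (avoids 0 (real n))) \<longlonglongrightarrow> 0"
    using filterlim_compose[OF survival_tendsto_0 filterlim_real_sequentially]
    by (simp add: survival_def[abs_def])
  ultimately show ?thesis unfolding never_hits_eq using LIMSEQ_unique by blast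
qed

text \<open>Right continuity enters twice. A visit at some \<open>s\<close> up to \<open>t\<close>
  is followed at once by further visits, which forces the infimum down to \<open>s\<close> even if
  \<open>s = 0\<close>; and avoidance up to \<open>t\<close> persists a little beyond
  \<open>t\<close>, which makes the inequality strict.\<close>

lemma hitting_time_gt_iff:
  assumes "\<omega> \<in> ever_hits" "t \<ge> 0"
  shows "H \<omega> > t \<longleftrightarrow> \<omega> \<in> avoids 0 t"
proof -
  let ?T = "{t. t > 0 \<and> X t \<omega> \<in> A}"
  have sp: "\<omega> \<in> space M" and ne: "?T \<noteq> {}" using assms by (auto simp: ever_hits_def)
  have bdd: "bdd_below ?T" by (rule bdd_belowI[of _ 0]) auto
  show ?thesis
  proof
    assume gt: "H \<omega> > t"
    have "X s \<omega> \<notin> A" if s: "s \<in> {0..0 + t}" for s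
    proof
      assume "X s \<omega> \<in> A"
      then obtain v where v: "v > s" "v < s + (H \<omega> - t)" "X v \<omega> \<in> A"
        using hits_immediately[OF sp _ _, of s "H \<omega> - t"] s gt by auto
      then have "H \<omega> \<le> v" unfolding hitting_time_def using that by (intro cInf_lower bdd) auto
      then show False using v that by simp
    qed
    then show "\<omega> \<in> avoids 0 t" using sp by (simp add: avoids_def)
  next
    assume av: "\<omega> \<in> avoids 0 t"
    obtain d where d: "d > 0" "\<And>s. t \<le> s \<Longrightarrow> s < t + d \<Longrightarrow> X s \<omega> = X t \<omega>"
      using X_right_cont[OF sp assms(2)] by blast
    have "t + d \<le> H \<omega>" unfolding hitting_time_def
    proof (rule cInf_greatest[OF ne])
      fix v assume v: "v \<in> ?T"
      show "t + d \<le> v"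
      proof (rule ccontr)
        assume "\<not> t + d \<le> v"
        then have "X v \<omega> \<notin> A"
          using d(2)[of v] av v assms(2) by (cases "v \<le> t") (auto simp: avoids_def)
        then show False using v by simp
      qed
    qed
    then show "H \<omega> > t" using d(1) by simp
  qed
qed

lemma hitting_time_nonneg: "\<omega> \<in> ever_hits \<Longrightarrow> H \<omega> \<ge> 0"
  unfolding hitting_time_def ever_hits_def by (intro cInf_greatest) auto

lemma hitting_time_never: "\<omega> \<in> space M - ever_hits \<Longrightarrow> H \<omega> = Inf {}"
  unfolding hitting_time_def ever_hits_def by (intro arg_cong[where f = Inf]) auto

lemma hitting_time_measurable: "H \<in> borel_measurable M"
  unfolding borel_measurable_iff_greater
proof
  fix a :: real
  have "{\<omega> \<in> space M. a < H \<omega>} = {\<omega> \<in> ever_hits. a < H \<omega>} \<union> {\<omega> \<in> space M - ever_hits. a < H \<omega>}"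
    by (auto simp: ever_hits_def)
  \<comment> \<open>Here \<open>H\<close> is the constant \<open>Inf {}\<close>; whatever its value,
    the set is everything or empty.\<close>
  also have "{\<omega> \<in> space M - ever_hits. a < H \<omega>} = (if a < Inf {} then space M - ever_hits else {})"
    using hitting_time_never by auto
  also have "{\<omega> \<in> ever_hits. a < H \<omega>} = (if a \<ge> 0 then ever_hits \<inter> avoids 0 a else ever_hits)"
  proof (cases "a \<ge> 0")
    case True
    then show ?thesis using hitting_time_gt_iff by auto
  next
    case False
    then have "a < H \<omega>" if "\<omega> \<in> ever_hits" for \<omega> using hitting_time_nonneg[OF that] by simp
    then show ?thesis using False by auto
  qed
  also have "\<dots> \<union> (if a < Inf {} then space M - ever_hits else {}) \<in> sets M"
    using ever_hits_sets avoids_sets[of 0 a] by auto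
  finally show "{\<omega> \<in> space M. a < H \<omega>} \<in> sets M" .
qed

lemma AE_ever_hits: "AE \<omega> in M. \<omega> \<in> ever_hits"
proof (rule AE_I)
  show "{\<omega> \<in> space M. \<omega> \<notin> ever_hits} \<subseteq> space M - ever_hits" by auto
  show "emeasure M (space M - ever_hits) = 0" using prob_never_hits by (simp add: emeasure_eq_measure)
  show "space M - ever_hits \<in> sets M" using ever_hits_sets by auto
qed

lemma prob_hitting_time_gt:
  assumes "t \<ge> 0"
  shows "prob {\<omega> \<in> space M. t < H \<omega>} = survival t"
  unfolding survival_def
proof (rule measure_eq_AE)
  show "AE \<omega> in M. \<omega> \<in> {\<omega> \<in> space M. t < H \<omega>} \<longleftrightarrow> \<omega> \<in> avoids 0 t"
    using AE_ever_hits by eventually_elim (use hitting_time_gt_iff assms in \<open>auto simp: avoids_def\<close>)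
  show "{\<omega> \<in> space M. t < H \<omega>} \<in> sets M"
    using hitting_time_measurable unfolding borel_measurable_iff_greater by blast
qed (use avoids_sets assms in auto)

lemma expectation_hitting_time: "expectation H = (LINT t|lborel. indicator {0..} t * survival t)"
proof -
  have nn: "AE \<omega> in M. H \<omega> \<ge> 0" using AE_ever_hits by eventually_elim (rule hitting_time_nonneg)
  have "expectation H = enn2real (\<integral>\<^sup>+\<omega>. ennreal (H \<omega>) \<partial>M)"
    using hitting_time_measurable nn by (rule integral_eq_nn_integral)
  also have "(\<integral>\<^sup>+\<omega>. ennreal (H \<omega>) \<partial>M) = (\<integral>\<^sup>+t. ennreal (indicator {0..} t * prob {\<omega> \<in> space M. t < H \<omega>}) \<partial>lborel)"
    using hitting_time_measurable nn by (rule nn_integral_eq_tail)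
  also have "\<dots> = (\<integral>\<^sup>+t. ennreal (indicator {0..} t * survival t) \<partial>lborel)"
    by (intro nn_integral_cong) (auto simp: indicator_def prob_hitting_time_gt)
  also have "enn2real \<dots> = (LINT t|lborel. indicator {0..} t * survival t)"
    using survival_integrable survival_bounds
    by (intro integral_eq_nn_integral[symmetric]) auto
  finally show ?thesis .
qed

lemma prob_hitting_time_le:
  "prob {\<omega> \<in> space M. H \<omega> \<le> t} = (if t \<ge> 0 then 1 - survival t else 0)"
proof (cases "t \<ge> 0")
  case True
  have gt: "{\<omega> \<in> space M. t < H \<omega>} \<in> sets M"
    using hitting_time_measurable unfolding borel_measurable_iff_greater by blast
  have "{\<omega> \<in> space M. H \<omega> \<le> t} = space M - {\<omega> \<in> space M. t < H \<omega>}" by auto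
  then show ?thesis using prob_compl[OF gt] prob_hitting_time_gt[OF True] True by simp
next
  case False
  have "prob {\<omega> \<in> space M. H \<omega> \<le> t} = prob {}"
  proof (rule measure_eq_AE)
    show "AE \<omega> in M. \<omega> \<in> {\<omega> \<in> space M. H \<omega> \<le> t} \<longleftrightarrow> \<omega> \<in> {}"
      using AE_ever_hits by eventually_elim (use hitting_time_nonneg False in force)
    show "{\<omega> \<in> space M. H \<omega> \<le> t} \<in> sets M"
      using hitting_time_measurable unfolding borel_measurable_iff_le by blast
  qed auto
  then show ?thesis using False by simp
qed

end

section \<open>Convergence in distribution\<close>

lemma cdf_exponential_density_1:
  "cdf (density lborel (exponential_density 1)) x = (if x \<ge> 0 then 1 - exp (- x) else 0)"
proof -
  let ?D = "density lborel (exponential_density 1)"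
  interpret prob_space ?D by (rule prob_space_exponential_density) simp
  have D: "distributed ?D lborel (\<lambda>x. x) (exponential_density 1)"
    unfolding distributed_def by (auto simp: distr_id2 sets_density)
  have pos: "prob {..a} = 1 - exp (- a)" if "a \<ge> 0" for a
    using exponential_distributedD_le[OF D that] by (simp add: atMost_def)
  show ?thesis
  proof (cases "x \<ge> 0")
    case True
    then show ?thesis using pos by (simp add: cdf_def)
  next
    case False
    then have "prob {..x} \<le> prob {..0}" by (intro finite_measure_mono) auto
    then have "prob {..x} \<le> 0" using pos[of 0] by simp
    then have "prob {..x} = 0" using measure_nonneg[of ?D "{..x}"] by linarith
    then show ?thesis using False by (simp add: cdf_def)
  qed
qed

theorem theorem3p1:
  fixes Om :: "nat \<Rightarrow> 'a set"
    and R :: "nat \<Rightarrow> 'a \<Rightarrow> 'a \<Rightarrow> real"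
    and \<nu> :: "nat \<Rightarrow> 'a \<Rightarrow> real"
    and A :: "nat \<Rightarrow> 'a set"
    and M :: "nat \<Rightarrow> 'b measure"
    and X :: "nat \<Rightarrow> real \<Rightarrow> 'b \<Rightarrow> 'a"
  assumes fin: "\<And>N. finite (Om N)"
    and nonempty: "\<And>N. Om N \<noteq> {}"
    and rates: "\<And>N. nonneg_rates (Om N) (R N)"
    and irred: "\<And>N. irreducible_chain (Om N) (R N)"
    and stat: "\<And>N. unique_stationary (Om N) (R N) (\<nu> N)"
    and proc: "\<And>N. ctmc_process (M N) (X N) (Om N) (R N) (\<nu> N)"
    and A_sub: "\<And>N. A N \<subseteq> Om N"
    and A_small: "(\<lambda>N. \<Sum>x\<in>A N. \<nu> N x) \<longlonglongrightarrow> 0"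
    and r_pos: "\<And>N. rate_into (Om N) (R N) (\<nu> N) (A N) > 0"
    and mix: "(\<lambda>N. mixing_time (Om N) (R N) (\<nu> N) / inverse (rate_into (Om N) (R N) (\<nu> N) (A N)))
                \<longlonglongrightarrow> 0"
  shows "weak_conv_m
           (\<lambda>N. distr (M N) borel
              (\<lambda>\<omega>. hitting_time (X N) (A N) \<omega> / (\<integral>\<omega>'. hitting_time (X N) (A N) \<omega>' \<partial>M N)))
           (density lborel (exponential_density 1))"
proof -
  have loc: "stationary_ctmc_hitting (M N) (Om N) (R N) (\<nu> N) (X N) (A N)" for N
    using fin rates irred stat proc A_sub r_pos unfolding unique_stationary_def
    by (intro stationary_ctmc_hitting.intro stationary_ctmc.intro stationary_ctmc_axioms.intro
        stationary_ctmc_hitting_axioms.intro) (auto simp: ctmc_process_def)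
  interpret stationary_ctmc_hitting "M N" "Om N" "R N" "\<nu> N" "X N" "A N" for N by (rule loc)
  define rt where "rt N = rate_into (Om N) (R N) (\<nu> N) (A N)" for N
  define E where "E N = (\<integral>\<omega>'. hitting_time (X N) (A N) \<omega>' \<partial>M N)" for N
  have E: "E N = (LINT t|lborel. indicator {0..} t * survival N t)" for N
    unfolding E_def by (rule expectation_hitting_time)
  have start: "(\<lambda>N. survival N 0) \<longlonglongrightarrow> 1"
    unfolding survival_0 using tendsto_diff[OF tendsto_const A_small, of 1] by simp
  have quasi: "eventually (\<lambda>N. \<exists>S D. S \<ge> 0 \<and> D \<le> e \<and> rt N * S \<le> e \<and>
        (\<forall>t s. t \<ge> 0 \<longrightarrow> s \<ge> 0 \<longrightarrow> \<bar>survival N (t + s) - survival N t * survival N s\<bar> \<le> e \<and>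
           survival N (t + S + s) \<le> survival N t * (survival N s + D))) sequentially" if e: "e > 0" for e
  proof -
    have "eventually (\<lambda>k. (1 / 2 :: real) ^ k < e / 2) sequentially"
      using e by (intro order_tendstoD[OF LIMSEQ_power_zero]) auto
    then obtain k where "\<And>j. j \<ge> k \<Longrightarrow> (1 / 2 :: real) ^ j < e / 2"
      unfolding eventually_sequentially by blast
    from this[of "Suc k"] have k: "(1 / 2 :: real) ^ Suc k < e / 2" by simp
    define K where "K = real (Suc k)"
    have K: "K > 0" by (simp add: K_def)
    \<comment> \<open>The gap will be \<open>K\<close> times some \<open>T\<close> with distance at
      most 1/2. One share \<open>e / (4 * K)\<close> bounds the mixing time relative to
      \<open>1 / rt N\<close>, a second one the excess of \<open>T\<close> over it; multiplied by
      \<open>K\<close> they give \<open>rt N * S < e / 2\<close>, which leaves \<open>e / 2\<close>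
      for \<open>D\<close>.\<close>
    have "eventually (\<lambda>N. mixing_time (Om N) (R N) (\<nu> N) / inverse (rt N) < e / (4 * K)) sequentially"
      using mix e K unfolding rt_def by (intro order_tendstoD) auto
    then show ?thesis
    proof eventually_elim
      case (elim N)
      have rt: "rt N > 0" using r_pos by (simp add: rt_def)
      obtain T where T: "T > 0" "mixed N T (1/2)" "T < mixing_time (Om N) (R N) (\<nu> N) + e / (4 * K) / rt N"
        using exists_mixed_near_mixing_time[OF nonempty, of "e / (4 * K) / rt N" N] e K rt by auto
      define S where "S = K * T"
      define D :: real where "D = (1 / 2) ^ Suc k"
      have mx: "mixed N S D" unfolding S_def D_def K_def by (rule mixed_pow[OF T(2) nonempty])
      have "rt N * T < rt N * (mixing_time (Om N) (R N) (\<nu> N) + e / (4 * K) / rt N)"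
        using T(3) rt by simp
      also have "\<dots> = mixing_time (Om N) (R N) (\<nu> N) / inverse (rt N) + e / (4 * K)"
        using rt by (simp add: field_simps)
      also have "\<dots> < e / (4 * K) + e / (4 * K)" using elim by simp
      finally have "K * (rt N * T) < K * (e / (4 * K) + e / (4 * K))"
        using K by (rule mult_strict_left_mono)
      also have "\<dots> = e / 2" using K by (simp add: field_simps)
      finally have rS: "rt N * S < e / 2" by (simp add: S_def ac_simps)
      have D: "0 \<le> D" "D < e / 2" using k by (simp_all add: D_def)
      show ?case
      proof (rule exI[of _ S], rule exI[of _ D], intro conjI allI impI)
        show "S \<ge> 0" using mx by (simp add: mixed_def)
        show "D \<le> e" "rt N * S \<le> e" using D rS e by auto
        fix t s :: real assume ts: "t \<ge> 0" "s \<ge> 0"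
        show "\<bar>survival N (t + s) - survival N t * survival N s\<bar> \<le> e"
          using survival_quasi[OF ts mx D(1)] D rS unfolding rt_def by linarith
        show "survival N (t + S + s) \<le> survival N t * (survival N s + D)"
          by (rule survival_upper[OF ts mx])
      qed
    qed
  qed
  have lims: "eventually (\<lambda>N. E N > 0) sequentially"
    "\<And>x. x \<ge> 0 \<Longrightarrow> (\<lambda>N. survival N (E N * x)) \<longlonglongrightarrow> exp (- x)"
    unfolding E
    by (rule quasi_exponential_limit[where r = rt and f = survival];
        use survival_antimono survival_bounds r_pos survival_lipschitz survival_tendsto_0 start quasi
        in \<open>simp add: rt_def\<close>)+
  show ?thesis
    unfolding weak_conv_m_def weak_conv_def
  proof (intro allI impI)
    fix x
    let ?F = "\<lambda>N. cdf (distr (M N) borel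
       (\<lambda>\<omega>. hitting_time (X N) (A N) \<omega> / (\<integral>\<omega>'. hitting_time (X N) (A N) \<omega>' \<partial>M N))) x"
    \<comment> \<open>The mean is known to be positive only for large \<open>N\<close>, so the
      division by it can be undone only eventually.\<close>
    have F: "eventually (\<lambda>N. (if x \<ge> 0 then 1 - survival N (E N * x) else 0) = ?F N) sequentially"
      using lims(1)
    proof eventually_elim
      case (elim N)
      have [measurable]: "hitting_time (X N) (A N) \<in> borel_measurable (M N)"
        by (rule hitting_time_measurable)
      have "?F N = measure (M N) {\<omega> \<in> space (M N). hitting_time (X N) (A N) \<omega> / E N \<le> x}"
        unfolding cdf_def E_def[symmetric]
        by (subst measure_distr) (auto intro!: arg_cong[where f = "measure (M N)"])
      also have "\<dots> = measure (M N) {\<omega> \<in> space (M N). hitting_time (X N) (A N) \<omega> \<le> E N * x}"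
        using elim by (simp add: pos_divide_le_eq mult.commute)
      also have "\<dots> = (if x \<ge> 0 then 1 - survival N (E N * x) else 0)"
        using prob_hitting_time_le[of N "E N * x"] elim by (simp add: zero_le_mult_iff)
      finally show ?case by simp
    qed
    have "(\<lambda>N. if x \<ge> 0 then 1 - survival N (E N * x) else 0)
        \<longlonglongrightarrow> cdf (density lborel (exponential_density 1)) x"
      using lims(2)[of x] by (cases "x \<ge> 0") (auto simp: cdf_exponential_density_1 intro!: tendsto_intros)
    then show "?F \<longlonglongrightarrow> cdf (density lborel (exponential_density 1)) x"
      using F by (rule Lim_transform_eventually)
  qed
qed

end
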